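(* For each positive integer $J$ let $\mathcal U(J)$ be the set of $q\in(1,J+1]$ such that $1$ has exactly one expansion $1=\sum_{i\ge1}d_iq^{-i}$ with $d_i\in\{0,1,\dots,J\}$. Let $M$ be a positive integer. (i) For every $K\in\{1,2,\dots,M\}$, \[\dim_H\Big(\bigcap_{J=K}^M\mathcal U(J)\Big)=\max_{1<q\le K+1}\dim_H\mathcal U_q^{(M)} .\] (ii) For every positive integer $L$, \[\dim_H\Big(\mathcal U(L)\setminus\bigcup_{J\ne L}\mathcal U(J)\Big)=1,\] where the union is over all positive integers $J\neq L$.
   Context: For $q\in(1,M+1]$, $\mathcal U^{(M)}_q$ denotes the set of $x\in[0,M/(q-1)]$ that have exactly one expansion $x=\sum_{i\ge1}x_iq^{-i}$ with all $x_i\in\{0,1,\dots,M\}$. *)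

theory Defs
  imports "HOL-Analysis.Analysis"
begin

definition is_expansion :: "nat \<Rightarrow> real \<Rightarrow> real \<Rightarrow> (nat \<Rightarrow> nat) \<Rightarrow> bool" where
  "is_expansion M q x d \<longleftrightarrow> (\<forall>i. d i \<le> M) \<and> (\<lambda>i. real (d i) / q ^ Suc i) sums x"

definition univoque_set :: "nat \<Rightarrow> real \<Rightarrow> real set" where
  "univoque_set M q = {x. 0 \<le> x \<and> x \<le> real M / (q - 1) \<and> (\<exists>!d. is_expansion M q x d)}"

definition univoque_bases :: "nat \<Rightarrow> real set" where
  "univoque_bases J = {q. 1 < q \<and> q \<le> real J + 1 \<and> (\<exists>!d. is_expansion J q 1 d)}"

definition hausdorff_content :: "real \<Rightarrow> real \<Rightarrow> real set \<Rightarrow> ennreal" where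
  "hausdorff_content s \<delta> A =
     (INF C \<in> {C :: nat \<Rightarrow> real set. A \<subseteq> (\<Union>i. C i) \<and> (\<forall>i. bounded (C i) \<and> diameter (C i) \<le> \<delta>)}.
        (\<Sum>i. ennreal (diameter (C i) powr s)))"

definition hausdorff_measure :: "real \<Rightarrow> real set \<Rightarrow> ennreal" where
  "hausdorff_measure s A = (SUP \<delta> \<in> {0<..}. hausdorff_content s \<delta> A)"

text \<open>Hausdorff dimension: inf of the s > 0 with H^s(A) = 0 (coincides with the
  usual inf over s >= 0 for subsets of the line).\<close>
definition hausdorff_dim :: "real set \<Rightarrow> real" where
  "hausdorff_dim A = Inf {s. 0 < s \<and> hausdorff_measure s A = 0}"

end

(* If q <= K + 1 <= J + 1 then 1 has a J-expansion in base q, and it is also an M-expansion for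
   M >= J. Hence the intersection in (i) consists of the q <= K + 1 in U(M). Put c = M - K and
   N = 2 K - M. If N <= 0, uniqueness leaves only constant expansions, and both sides of (i)
   are 0. If N > 0, all but finitely many digits of a nontrivial unique expansion lie in
   {c, ..., K}, and the maximum is s = ln (N + 1) / ln (K + 1), attained at q = K + 1.

   Upper bound (for c > 0; if c = 0 then s = 1): after c is subtracted from the digits, every tail of the expansion has value at most
   N / K. For s < s' < 1 the number of words of length n with this property is O(b^(s' n)) in
   base b, even when b is much smaller than K + 1.

   Lower bound: let free digits c + u with u in {0, ..., N} be interrupted once in every l places
   by the digits c and K. Then the values of all tails, also after reflection of the digits, are
   bounded away from 1, which gives uniqueness, and the values (or the bases that give the value 1)
   of two such sequences differ by at least a constant times (K + 1)^(-n) if the sequences differ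
   first at place n. As l grows, the dimensions tend to s.

   Part (ii) uses the same sequences with K = M = L: the bases exceed L, which excludes J < L, and a
   digit 0 after a positive digit is incompatible with uniqueness over the digits {0, ..., J} for
   J > L. *)
theory Submission
  imports Defs
begin

section \<open>Hausdorff null sets\<close>

text \<open>No bound on the diameters is needed for a positive exponent: a small sum forces small diameters.\<close>

definition covering_null :: "real \<Rightarrow> real set \<Rightarrow> bool" where
  "covering_null t A \<longleftrightarrow> (\<forall>\<epsilon>>0. \<exists>C :: nat \<Rightarrow> real set. A \<subseteq> (\<Union>i. C i) \<and> (\<forall>i. bounded (C i)) \<and>
      (\<Sum>i. ennreal (diameter (C i) powr t)) \<le> ennreal \<epsilon>)"

lemma hausdorff_measure_covering_null:
  assumes "covering_null t A" "0 < t"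
  shows "hausdorff_measure t A = 0"
proof -
  have "hausdorff_content t \<delta> A \<le> ennreal e" if d: "0 < \<delta>" and e: "0 < e" for \<delta> e :: real
  proof -
    have "0 < min e (\<delta> powr t)" using d e by simp
    then obtain C :: "nat \<Rightarrow> real set" where C: "A \<subseteq> (\<Union>i. C i)" "\<And>i. bounded (C i)"
      "(\<Sum>i. ennreal (diameter (C i) powr t)) \<le> ennreal (min e (\<delta> powr t))"
      using assms(1) unfolding covering_null_def by meson
    have "diameter (C i) \<le> \<delta>" for i
    proof -
      have "ennreal (diameter (C i) powr t) = (\<Sum>i\<in>{i}. ennreal (diameter (C i) powr t))" by simp
      also have "\<dots> \<le> (\<Sum>i. ennreal (diameter (C i) powr t))"
        by (rule sum_le_suminf) auto
      also have "\<dots> \<le> ennreal (\<delta> powr t)"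
        using C(3) by (rule order_trans) (auto intro: ennreal_leI)
      finally have "diameter (C i) powr t \<le> \<delta> powr t" by simp
      then show ?thesis
        using d assms(2) by (metis less_eq_real_def not_le powr_less_mono2)
    qed
    then have "hausdorff_content t \<delta> A \<le> (\<Sum>i. ennreal (diameter (C i) powr t))"
      unfolding hausdorff_content_def using C by (intro INF_lower) auto
    also have "\<dots> \<le> ennreal e" using C(3) by (rule order_trans) (auto intro: ennreal_leI)
    finally show ?thesis .
  qed
  then have "hausdorff_content t \<delta> A = 0" if "0 < \<delta>" for \<delta>
    using that by (metis add_0 ennreal_le_epsilon le_zero_eq)
  then show ?thesis unfolding hausdorff_measure_def by simp
qed

text \<open>Scale 1 suffices: once all diameters are at most 1, raising the exponent only lowers
  each term.\<close>

lemma covering_null_hausdorff_measure: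
  assumes "hausdorff_measure s A = 0" "0 < s" "s \<le> t"
  shows "covering_null t A"
  unfolding covering_null_def
proof (intro allI impI)
  fix e :: real assume e: "0 < e"
  have "hausdorff_content s 1 A \<le> hausdorff_measure s A"
    unfolding hausdorff_measure_def by (rule SUP_upper) simp
  then have "hausdorff_content s 1 A < ennreal e" using assms(1) e by simp
  then obtain C :: "nat \<Rightarrow> real set" where C: "A \<subseteq> (\<Union>i. C i)" "\<And>i. bounded (C i) \<and> diameter (C i) \<le> 1"
      "(\<Sum>i. ennreal (diameter (C i) powr s)) < ennreal e"
    unfolding hausdorff_content_def INF_less_iff by blast
  have "diameter (C i) powr t \<le> diameter (C i) powr s" for i
    using C(2)[of i] assms diameter_ge_0[of "C i"] by (intro powr_mono') auto
  then have "(\<Sum>i. ennreal (diameter (C i) powr t)) \<le> (\<Sum>i. ennreal (diameter (C i) powr s))"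
    by (intro suminf_le ennreal_leI) auto
  then show "\<exists>C :: nat \<Rightarrow> real set. A \<subseteq> (\<Union>i. C i) \<and> (\<forall>i. bounded (C i)) \<and>
      (\<Sum>i. ennreal (diameter (C i) powr t)) \<le> ennreal e"
    using C by (intro exI[of _ C]) auto
qed

lemma covering_null_subset:
  assumes "covering_null t B" "A \<subseteq> B"
  shows "covering_null t A"
  using assms unfolding covering_null_def by (meson order_trans)

lemma covering_null_UN:
  fixes A :: "nat \<Rightarrow> real set"
  assumes "\<And>n. covering_null t (A n)"
  shows "covering_null t (\<Union>n. A n)"
  unfolding covering_null_def
proof (intro allI impI)
  fix e :: real assume e: "0 < e"
  have "\<forall>n. \<exists>C :: nat \<Rightarrow> real set. A n \<subseteq> (\<Union>i. C i) \<and> (\<forall>i. bounded (C i)) \<and>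
      (\<Sum>i. ennreal (diameter (C i) powr t)) \<le> ennreal (e * (1/2) ^ Suc n)"
    using assms e unfolding covering_null_def by simp
  then obtain C :: "nat \<Rightarrow> nat \<Rightarrow> real set" where C: "\<And>n. A n \<subseteq> (\<Union>i. C n i)" "\<And>n i. bounded (C n i)"
      "\<And>n. (\<Sum>i. ennreal (diameter (C n i) powr t)) \<le> ennreal (e * (1/2) ^ Suc n)"
    by metis
  define D where "D k = (case prod_decode k of (n, i) \<Rightarrow> C n i)" for k
  have "(\<Sum>k. ennreal (diameter (D k) powr t)) =
      (\<Sum>k. (\<lambda>(n, i). ennreal (diameter (C n i) powr t)) (prod_decode k))"
    by (simp add: D_def split_beta)
  also have "\<dots> = (\<Sum>n. \<Sum>i. ennreal (diameter (C n i) powr t))"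
    by (rule suminf_ennreal_2dimen) simp
  also have "\<dots> \<le> (\<Sum>n. ennreal (e * (1/2) ^ Suc n))"
    using C(3) by (intro suminf_le) auto
  also have "\<dots> = ennreal e"
    using sums_mult[OF power_half_series, of e] e
    by (subst suminf_ennreal2) (auto simp: sums_iff)
  finally have "(\<Sum>k. ennreal (diameter (D k) powr t)) \<le> ennreal e" .
  moreover have "(\<Union>n. A n) \<subseteq> (\<Union>k. D k)"
  proof safe
    fix x n assume "x \<in> A n"
    then obtain i where "x \<in> C n i" using C(1) by blast
    then show "x \<in> (\<Union>k. D k)" by (intro UN_I[of "prod_encode (n, i)"]) (auto simp: D_def)
  qed
  moreover have "bounded (D k)" for k using C(2) by (auto simp: D_def split: prod.splits)
  ultimately show "\<exists>C :: nat \<Rightarrow> real set. (\<Union>n. A n) \<subseteq> (\<Union>i. C i) \<and> (\<forall>i. bounded (C i)) \<and>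
      (\<Sum>i. ennreal (diameter (C i) powr t)) \<le> ennreal e" by blast
qed

lemma covering_null_countable_UN:
  assumes "countable I" "\<And>i. i \<in> I \<Longrightarrow> covering_null t (A i)"
  shows "covering_null t (\<Union>i\<in>I. A i)"
proof (cases "I = {}")
  case True
  then show ?thesis unfolding covering_null_def by (auto intro!: exI[of _ "\<lambda>_. {}"])
next
  case False
  have "covering_null t (\<Union>n. A (from_nat_into I n))"
    using assms False by (intro covering_null_UN) (auto simp: from_nat_into)
  then show ?thesis
    using range_from_nat_into[OF False assms(1)] by (metis image_image)
qed

text \<open>The classes of equal code at level n form a cover by at most D r^n sets of diameter at
  most B rho^n. Its t-sum is at most D B^t (r rho^t)^n, which tends to 0.\<close>

lemma covering_null_codes:
  fixes \<pi> :: "nat \<Rightarrow> real \<Rightarrow> 'c"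
  assumes fin: "\<And>n. finite (F n)" and card: "\<And>n. real (card (F n)) \<le> D * r ^ n"
    and code: "\<And>n x. x \<in> A \<Longrightarrow> \<pi> n x \<in> F n"
    and close: "\<And>n x y. x \<in> A \<Longrightarrow> y \<in> A \<Longrightarrow> \<pi> n x = \<pi> n y \<Longrightarrow> \<bar>x - y\<bar> \<le> B * \<rho> ^ n"
    and pos: "0 < t" "0 \<le> r" "0 < \<rho>" "r * \<rho> powr t < 1" "0 < B" "0 < D"
  shows "covering_null t A"
  unfolding covering_null_def
proof (intro allI impI)
  fix e :: real assume e: "0 < e"
  have "(\<lambda>n. D * B powr t * (r * \<rho> powr t) ^ n) \<longlonglongrightarrow> D * B powr t * 0"
    using pos by (intro tendsto_mult tendsto_const LIMSEQ_realpow_zero) auto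
  then have "eventually (\<lambda>n. D * B powr t * (r * \<rho> powr t) ^ n < e) sequentially"
    using e by (auto dest: order_tendstoD)
  then obtain n where n: "D * B powr t * (r * \<rho> powr t) ^ n < e"
    by (auto simp: eventually_sequentially)
  define k where "k = card (F n)"
  obtain h where h: "bij_betw h {..<k} (F n)"
    using ex_bij_betw_nat_finite[OF fin[of n]] by (auto simp: k_def atLeast0LessThan)
  define C where "C i = (if i < k then {x \<in> A. \<pi> n x = h i} else {})" for i
  have dist: "dist x y \<le> B * \<rho> ^ n" if "x \<in> C i" "y \<in> C i" for x y i
    using that close[of x y n] by (auto simp: C_def dist_real_def split: if_splits)
  have bdd: "bounded (C i)" for i
    using dist unfolding bounded_def by (metis (full_types))
  have "diameter (C i) \<le> B * \<rho> ^ n" for i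
    using dist pos by (intro diameter_le) (auto simp: dist_real_def less_imp_le)
  then have diam: "diameter (C i) powr t \<le> B powr t * (\<rho> powr t) ^ n" for i
  proof -
    assume "\<And>i. diameter (C i) \<le> B * \<rho> ^ n"
    then have "diameter (C i) powr t \<le> (B * \<rho> ^ n) powr t"
      using pos bdd by (intro powr_mono2) (auto simp: diameter_ge_0)
    also have "\<dots> = B powr t * (\<rho> powr t) ^ n"
      using pos by (simp add: powr_mult powr_powr powr_realpow[symmetric] mult.commute)
    finally show ?thesis .
  qed
  have "(\<Sum>i. ennreal (diameter (C i) powr t)) = (\<Sum>i<k. ennreal (diameter (C i) powr t))"
    using pos(1) by (intro suminf_finite) (auto simp: C_def)
  also have "\<dots> \<le> (\<Sum>i<k. ennreal (B powr t * (\<rho> powr t) ^ n))"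
    by (intro sum_mono ennreal_leI diam)
  also have "\<dots> = ennreal (real k * (B powr t * (\<rho> powr t) ^ n))"
    by (simp add: ennreal_mult ennreal_of_nat_eq_real_of_nat)
  also have "\<dots> \<le> ennreal (D * r ^ n * (B powr t * (\<rho> powr t) ^ n))"
    using card[of n] by (intro ennreal_leI mult_right_mono) (auto simp: k_def)
  also have "\<dots> \<le> ennreal e"
    using n by (intro ennreal_leI) (simp add: power_mult_distrib mult_ac)
  finally have "(\<Sum>i. ennreal (diameter (C i) powr t)) \<le> ennreal e" .
  moreover have "A \<subseteq> (\<Union>i. C i)"
  proof
    fix x assume x: "x \<in> A"
    then have "\<pi> n x \<in> h ` {..<k}" using code h by (simp add: bij_betw_def)
    then show "x \<in> (\<Union>i. C i)" using x by (auto simp: C_def)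
  qed
  ultimately show "\<exists>C :: nat \<Rightarrow> real set. A \<subseteq> (\<Union>i. C i) \<and> (\<forall>i. bounded (C i)) \<and>
      (\<Sum>i. ennreal (diameter (C i) powr t)) \<le> ennreal e" using bdd by blast
qed

text \<open>Dyadic intervals serve as codes: there are O(2^n) of length 2^(-n), and 2 * 2^(-t) < 1
  for t > 1.\<close>

lemma covering_null_bounded:
  assumes "bounded A" "1 < t"
  shows "covering_null t A"
proof -
  obtain b where b: "\<And>x. x \<in> A \<Longrightarrow> \<bar>x\<bar> \<le> b" using assms(1) by (auto simp: bounded_iff)
  define m where "m = nat \<lceil>b\<rceil>"
  have m: "\<bar>x\<bar> \<le> real m" if "x \<in> A" for x
    using b[OF that] unfolding m_def by linarith
  show ?thesis
  proof (rule covering_null_codes[where \<pi> = "\<lambda>n x. \<lfloor>2 ^ n * x\<rfloor>" and F = "\<lambda>n. {- int (m * 2 ^ n)..int (m * 2 ^ n)}"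
        and D = "2 * m + 1" and r = 2 and \<rho> = "1 / 2" and B = 1])
    fix n x assume "x \<in> A"
    then have "\<bar>2 ^ n * x\<bar> \<le> real (m * 2 ^ n)"
      using m[of x] by (simp add: abs_mult mult.commute)
    then have "- real (m * 2 ^ n) \<le> 2 ^ n * x" "2 ^ n * x < real (m * 2 ^ n) + 1"
      by (simp_all only: abs_le_iff, linarith+)
    then show "\<lfloor>2 ^ n * x\<rfloor> \<in> {- int (m * 2 ^ n)..int (m * 2 ^ n)}"
      by (simp only: atLeastAtMost_iff le_floor_iff floor_le_iff of_int_minus of_int_of_nat_eq simp_thms)
  next
    fix n and x y :: real assume "\<lfloor>2 ^ n * x\<rfloor> = \<lfloor>2 ^ n * y\<rfloor>"
    then have "\<bar>2 ^ n * x - 2 ^ n * y\<bar> \<le> 1" by linarith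
    then have "2 ^ n * \<bar>x - y\<bar> \<le> 1" by (simp flip: right_diff_distrib add: abs_mult)
    then show "\<bar>x - y\<bar> \<le> 1 * (1 / 2) ^ n" by (simp add: field_simps)
  next
    fix n
    have "(1::real) \<le> 2 ^ n" by simp
    then have "1 + 2 * real m * 2 ^ n \<le> 2 ^ n + 2 * real m * 2 ^ n" by linarith
    then show "real (card {- int (m * 2 ^ n)..int (m * 2 ^ n)}) \<le> real (2 * m + 1) * 2 ^ n"
      by (simp add: algebra_simps nat_add_distrib nat_mult_distrib)
  next
    have "(1 / 2 :: real) powr t < (1 / 2) powr 1"
      using assms(2) by (intro powr_less_mono') auto
    then show "2 * (1 / 2 :: real) powr t < 1" by simp
  qed (use assms in auto)
qed

text \<open>The inverse of g is Hoelder of exponent tau, so a cover of A with small tau-sum pulls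
  back to a cover of [0,1) by intervals of small total length. Enclosing each preimage in an
  interval avoids any measurability question about g.\<close>

lemma not_covering_null_hoelder:
  fixes g :: "real \<Rightarrow> real"
  assumes maps: "\<And>t. t \<in> {0..<1} \<Longrightarrow> g t \<in> A"
    and hoelder: "\<And>t u. t \<in> {0..<1} \<Longrightarrow> u \<in> {0..<1} \<Longrightarrow> \<bar>t - u\<bar> \<le> B * \<bar>g t - g u\<bar> powr \<tau>"
    and pos: "0 < B" "0 < \<tau>"
  shows "\<not> covering_null \<tau> A"
proof
  assume "covering_null \<tau> A"
  \<comment> \<open>The bound 1 / (4 B) makes the intervals below, of length 2 B diam^tau, have
    total length at most 1/2.\<close>
  then obtain C :: "nat \<Rightarrow> real set" where C: "A \<subseteq> (\<Union>i. C i)" "\<And>i. bounded (C i)"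
      "(\<Sum>i. ennreal (diameter (C i) powr \<tau>)) \<le> ennreal (1 / (4 * B))"
    using pos unfolding covering_null_def by (metis divide_pos_pos mult_pos_pos zero_less_numeral zero_less_one)
  define r where "r i = B * diameter (C i) powr \<tau>" for i
  define T where "T i = {t \<in> {0..<1}. g t \<in> C i}" for i
  \<comment> \<open>If \<open>T i\<close> is empty, \<open>a i\<close> is arbitrary; the inclusion
    below is then trivial.\<close>
  define a where "a i = (SOME t. t \<in> T i)" for i
  have sub: "T i \<subseteq> {a i - r i..a i + r i}" for i
  proof
    fix t assume t: "t \<in> T i"
    then have a: "a i \<in> T i" unfolding a_def by (rule someI)
    have "\<bar>g t - g (a i)\<bar> \<le> diameter (C i)"
      using diameter_bounded_bound[OF C(2)[of i], of "g t" "g (a i)"] t a by (auto simp: T_def dist_real_def)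
    then have "\<bar>g t - g (a i)\<bar> powr \<tau> \<le> diameter (C i) powr \<tau>"
      using pos by (intro powr_mono2) auto
    moreover have "\<bar>t - a i\<bar> \<le> B * \<bar>g t - g (a i)\<bar> powr \<tau>"
      using t a by (intro hoelder) (auto simp: T_def)
    ultimately have "\<bar>t - a i\<bar> \<le> r i"
      unfolding r_def by (meson mult_left_mono order_trans less_imp_le pos(1))
    then show "t \<in> {a i - r i..a i + r i}" by auto
  qed
  have r0: "0 \<le> r i" for i using pos by (simp add: r_def)
  have "{0..<1} \<subseteq> (\<Union>i. {a i - r i..a i + r i})"
  proof
    fix t :: real assume t: "t \<in> {0..<1}"
    then obtain i where "t \<in> T i" using maps[OF t] C(1) by (auto simp: T_def)
    then show "t \<in> (\<Union>i. {a i - r i..a i + r i})" using sub by blast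
  qed
  then have "emeasure lborel {0..<1::real} \<le> emeasure lborel (\<Union>i. {a i - r i..a i + r i})"
    by (intro emeasure_mono) auto
  also have "\<dots> \<le> (\<Sum>i. emeasure lborel {a i - r i..a i + r i})"
    by (intro emeasure_subadditive_countably) auto
  also have "\<dots> = (\<Sum>i. ennreal (2 * B) * ennreal (diameter (C i) powr \<tau>))"
    using r0 pos by (intro suminf_cong) (auto simp: r_def simp flip: ennreal_mult)
  also have "\<dots> = ennreal (2 * B) * (\<Sum>i. ennreal (diameter (C i) powr \<tau>))" by simp
  also have "\<dots> \<le> ennreal (2 * B) * ennreal (1 / (4 * B))"
    by (intro mult_left_mono C(3)) auto
  also have "\<dots> = ennreal (1 / 2)" using pos by (simp flip: ennreal_mult)
  finally have "ennreal 1 \<le> ennreal (1 / 2)" by simp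
  then show False by (subst (asm) ennreal_le_iff) auto
qed

section \<open>Bounds for the Hausdorff dimension\<close>

lemma hausdorff_dim_le:
  assumes "\<And>t. s < t \<Longrightarrow> covering_null t A" "0 \<le> s"
  shows "hausdorff_dim A \<le> s"
proof (rule field_le_epsilon)
  fix e :: real assume "0 < e"
  then show "hausdorff_dim A \<le> s + e"
    unfolding hausdorff_dim_def using assms
    by (intro cInf_lower) (auto intro!: hausdorff_measure_covering_null bdd_belowI[of _ 0])
qed

text \<open>A smaller exponent of measure zero would make A null at tau as well. Boundedness makes
  the set of exponents nonempty, so that its infimum is meaningful.\<close>

lemma hausdorff_dim_ge:
  assumes "\<not> covering_null \<tau> A" "bounded A"
  shows "\<tau> \<le> hausdorff_dim A"
  unfolding hausdorff_dim_def
proof (rule cInf_greatest)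
  have "hausdorff_measure 2 A = 0"
    using assms by (intro hausdorff_measure_covering_null covering_null_bounded) auto
  then show "{s. 0 < s \<and> hausdorff_measure s A = 0} \<noteq> {}" by (auto intro!: exI[of _ 2])
next
  fix s assume "s \<in> {s. 0 < s \<and> hausdorff_measure s A = 0}"
  then show "\<tau> \<le> s" using assms(1) covering_null_hausdorff_measure[of s A \<tau>] by force
qed

lemma hausdorff_dim_nonneg:
  assumes "bounded A"
  shows "0 \<le> hausdorff_dim A"
  unfolding hausdorff_dim_def
proof (rule cInf_greatest)
  have "hausdorff_measure 2 A = 0"
    using assms by (intro hausdorff_measure_covering_null covering_null_bounded) auto
  then show "{s. 0 < s \<and> hausdorff_measure s A = 0} \<noteq> {}" by (auto intro!: exI[of _ 2])
qed auto

lemma covering_null_countable: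
  assumes "countable A" "0 < t"
  shows "covering_null t A"
proof -
  have "covering_null t {x}" for x
    unfolding covering_null_def using assms(2) by (intro allI impI exI[of _ "\<lambda>_. {x}"]) simp
  then show ?thesis using covering_null_countable_UN[OF assms(1), of t "\<lambda>x. {x}"] by simp
qed

section \<open>Expansions\<close>

definition val :: "real \<Rightarrow> (nat \<Rightarrow> nat) \<Rightarrow> real" where
  "val q d = (\<Sum>i. real (d i) / q ^ Suc i)"

definition drop_digits :: "nat \<Rightarrow> (nat \<Rightarrow> nat) \<Rightarrow> nat \<Rightarrow> nat" where
  "drop_digits n d i = d (n + i)"

lemma drop_digits_drop_digits [simp]: "drop_digits m (drop_digits n d) = drop_digits (n + m) d"
  by (simp add: drop_digits_def fun_eq_iff add.assoc)

lemma drop_digits_0 [simp]: "drop_digits 0 d = d"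
  by (simp add: drop_digits_def fun_eq_iff)

lemma sums_constant_digit:
  assumes "1 < q"
  shows "(\<lambda>i. c / q ^ Suc i) sums (c / (q - 1 :: real))"
proof -
  have "(\<lambda>i. (c / q) * (1 / q) ^ i) sums ((c / q) * (1 / (1 - 1 / q)))"
    using assms by (intro sums_mult geometric_sums) auto
  moreover have "(c / q) * (1 / (1 - 1 / q)) = c / (q - 1)" using assms by (simp add: field_simps)
  ultimately have "(\<lambda>i. (c / q) * (1 / q) ^ i) sums (c / (q - 1))" by (simp only:)
  then show ?thesis by (simp add: power_one_over)
qed

context
  fixes q :: real
  assumes q: "1 < q"
begin

lemma summable_digits:
  assumes "\<And>i. d i \<le> (M::nat)"
  shows "summable (\<lambda>i. real (d i) / q ^ Suc i)"
proof (rule summable_comparison_test'[OF sums_summable[OF sums_constant_digit[OF q, of "real M"]]])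
  show "norm (real (d i) / q ^ Suc i) \<le> real M / q ^ Suc i" for i
    using q assms[of i] by (simp add: divide_right_mono)
qed

lemma is_expansion_iff_val: "is_expansion M q x d \<longleftrightarrow> (\<forall>i. d i \<le> M) \<and> val q d = x"
  unfolding is_expansion_def val_def using summable_digits[of d M] by (auto simp: sums_iff)

lemma val_mono:
  assumes "\<And>i. d i \<le> e i" "\<And>i. e i \<le> (M::nat)"
  shows "val q d \<le> val q e"
  unfolding val_def
proof (rule suminf_le)
  show "real (d i) / q ^ Suc i \<le> real (e i) / q ^ Suc i" for i
    using q assms(1)[of i] by (intro divide_right_mono) auto
  show "summable (\<lambda>i. real (d i) / q ^ Suc i)"
    using assms by (intro summable_digits[of d M]) (meson le_trans)
qed (rule summable_digits[OF assms(2)])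

lemma val_const: "val q (\<lambda>_. c) = real c / (q - 1)"
  using sums_constant_digit[OF q, of "real c"] by (simp add: val_def sums_iff)

lemma val_nonneg: "(\<And>i. d i \<le> M) \<Longrightarrow> 0 \<le> val q d"
  unfolding val_def using q by (intro suminf_nonneg summable_digits) auto

lemma val_le:
  assumes "\<And>i. d i \<le> M"
  shows "val q d \<le> real M / (q - 1)"
  using val_mono[of d "\<lambda>_. M" M] assms by (simp add: val_const)

lemma val_split:
  assumes "\<And>i. d i \<le> M"
  shows "val q d = (\<Sum>i<n. real (d i) / q ^ Suc i) + val q (drop_digits n d) / q ^ n"
proof -
  have "val q d = (\<Sum>i. real (d (i + n)) / q ^ Suc (i + n)) + (\<Sum>i<n. real (d i) / q ^ Suc i)"
    unfolding val_def by (intro suminf_split_initial_segment summable_digits[of d M] assms)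
  also have "(\<Sum>i. real (d (i + n)) / q ^ Suc (i + n)) = (\<Sum>i. real (drop_digits n d i) / q ^ Suc i / q ^ n)"
    by (intro suminf_cong) (simp add: drop_digits_def power_add add.commute)
  also have "\<dots> = val q (drop_digits n d) / q ^ n"
    unfolding val_def using summable_digits[of "drop_digits n d" M] assms
    by (subst suminf_divide) (auto simp: drop_digits_def)
  finally show ?thesis by simp
qed

lemma val_step:
  assumes "\<And>i. d i \<le> M"
  shows "q * val q d = real (d 0) + val q (drop_digits 1 d)"
  using val_split[of d M 1] assms q by (simp add: field_simps)

lemma val_drop_step:
  assumes "\<And>i. d i \<le> M"
  shows "q * val q (drop_digits n d) = real (d n) + val q (drop_digits (Suc n) d)"
  using val_step[of "drop_digits n d" M] assms by (simp add: drop_digits_def[of n d 0]) (simp add: drop_digits_def)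

lemma val_minus:
  assumes "\<And>i. e i \<le> d i" "\<And>i. d i \<le> (M::nat)"
  shows "val q (\<lambda>i. d i - e i) = val q d - val q e"
proof -
  have "e i \<le> M" for i using assms by (meson le_trans)
  then have "val q d - val q e = (\<Sum>i. real (d i) / q ^ Suc i - real (e i) / q ^ Suc i)"
    unfolding val_def using assms by (intro suminf_diff summable_digits[of _ M])
  then show ?thesis using assms by (simp add: val_def of_nat_diff diff_divide_distrib)
qed

lemma val_diff_at:
  assumes "\<And>i. d i \<le> M" "\<And>i. e i \<le> N" "\<And>i. i < n \<Longrightarrow> d i = e i"
  shows "(val q e - val q d) * q ^ Suc n =
    real (e n) - real (d n) + val q (drop_digits (Suc n) e) - val q (drop_digits (Suc n) d)"
proof -
  have "(\<Sum>i<n. real (d i) / q ^ Suc i) = (\<Sum>i<n. real (e i) / q ^ Suc i)"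
    using assms(3) by (intro sum.cong) auto
  then have "val q e - val q d =
      (real (e n) - real (d n) + val q (drop_digits (Suc n) e) - val q (drop_digits (Suc n) d)) / q ^ Suc n"
    using val_split[of d M "Suc n", OF assms(1)] val_split[of e N "Suc n", OF assms(2)]
    by (simp add: diff_divide_distrib add_divide_distrib)
  then show ?thesis using q by simp
qed

text \<open>Greedy algorithm with digits capped at M. The remainders stay in [0, M / (q - 1)], so
  after division by q^n they vanish in the limit.\<close>

lemma exists_expansion:
  assumes "q \<le> real M + 1" "0 \<le> x" "x \<le> real M / (q - 1)"
  shows "\<exists>d. is_expansion M q x d"
proof -
  define dig where "dig y = min M (nat \<lfloor>q * y\<rfloor>)" for y :: real
  define r where "r n = ((\<lambda>y. q * y - real (dig y)) ^^ n) x" for n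
  define d where "d n = dig (r n)" for n
  \<comment> \<open>The right end of the range of values is the fixed point of y -> q y - M.\<close>
  have q_le: "q * (real M / (q - 1)) - real M = real M / (q - 1)"
    using q by (simp add: field_simps)
  have r: "0 \<le> r n \<and> r n \<le> real M / (q - 1)" for n
  proof (induction n)
    case (Suc n)
    have step: "r (Suc n) = q * r n - real (dig (r n))" by (simp add: r_def)
    have 0: "0 \<le> q * r n" using Suc q by simp
    show ?case
    proof (cases "nat \<lfloor>q * r n\<rfloor> \<le> M")
      case True
      then have "r (Suc n) = q * r n - of_int \<lfloor>q * r n\<rfloor>" using 0 by (simp add: step dig_def)
      \<comment> \<open>Here q <= M + 1 enters: an uncapped step leaves a fractional part, and [0,1)
        lies within the range.\<close>
      moreover have "1 \<le> real M / (q - 1)" using assms q by (simp add: field_simps)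
      ultimately show ?thesis by linarith
    next
      case False
      then have "r (Suc n) = q * r n - real M" by (simp add: step dig_def)
      moreover have "q * r n \<le> q * (real M / (q - 1))" using Suc q by (intro mult_left_mono) auto
      moreover have "real M \<le> q * r n" using False 0 by linarith
      ultimately show ?thesis using q_le by linarith
    qed
  qed (use assms in \<open>simp add: r_def\<close>)
  have partial: "(\<Sum>i<n. real (d i) / q ^ Suc i) = x - r n / q ^ n" for n
  proof (induction n)
    case (Suc n)
    have "r (Suc n) = q * r n - real (d n)" by (simp add: r_def d_def)
    moreover have "x - r n / q ^ n + real (d n) / q ^ Suc n = x - (q * r n - real (d n)) / q ^ Suc n"
      using q by (simp add: diff_divide_distrib)
    ultimately show ?case using Suc by simp
  qed (simp add: r_def)
  have "(\<lambda>n. r n / q ^ n) \<longlonglongrightarrow> 0"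
  proof (rule tendsto_sandwich[of "\<lambda>_. 0" _ _ "\<lambda>n. real M / (q - 1) * (1 / q) ^ n"])
    have "(\<lambda>n. real M / (q - 1) * (1 / q) ^ n) \<longlonglongrightarrow> real M / (q - 1) * 0"
      using q by (intro tendsto_mult tendsto_const LIMSEQ_realpow_zero) auto
    then show "(\<lambda>n. real M / (q - 1) * (1 / q) ^ n) \<longlonglongrightarrow> 0" by simp
    show "eventually (\<lambda>n. r n / q ^ n \<le> real M / (q - 1) * (1 / q) ^ n) sequentially"
    proof (intro always_eventually allI)
      fix n
      have "r n / q ^ n \<le> (real M / (q - 1)) / q ^ n" using r[of n] q by (intro divide_right_mono) auto
      then show "r n / q ^ n \<le> real M / (q - 1) * (1 / q) ^ n" by (simp add: power_one_over)
    qed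
  qed (use r q in auto)
  then have "(\<lambda>n. x - r n / q ^ n) \<longlonglongrightarrow> x - 0" by (intro tendsto_intros)
  then have "(\<lambda>i. real (d i) / q ^ Suc i) sums x" unfolding sums_def partial by simp
  then show ?thesis unfolding is_expansion_def by (intro exI[of _ d]) (simp add: d_def dig_def)
qed

text \<open>At the first place where a competitor differs, a digit difference of at least 1 must be
  made up by the tails. A larger digit of the competitor needs a tail of d of at least 1; a smaller
  one needs that tail to lie at least 1 below the maximum M / (q - 1).\<close>

lemma unique_expansionI:
  assumes d: "is_expansion M q x d"
    and up: "\<And>n. d n < M \<Longrightarrow> val q (drop_digits (Suc n) d) < 1"
    and down: "\<And>n. 0 < d n \<Longrightarrow> real M / (q - 1) - val q (drop_digits (Suc n) d) < 1"
  shows "\<exists>!d. is_expansion M q x d"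
proof (intro ex1I[of _ d] d, rule ccontr)
  fix e assume e: "is_expansion M q x e" and "e \<noteq> d"
  define n where "n = (LEAST n. d n \<noteq> e n)"
  have "\<exists>n. d n \<noteq> e n" using \<open>e \<noteq> d\<close> by auto
  then have n: "d n \<noteq> e n" unfolding n_def by (rule LeastI_ex)
  have lt: "d i = e i" if "i < n" for i using not_less_Least[of i "\<lambda>n. d n \<noteq> e n"] that by (auto simp: n_def)
  have bd: "\<And>i. d i \<le> M" "\<And>i. e i \<le> M" "val q d = x" "val q e = x"
    using d e by (auto simp: is_expansion_iff_val)
  define s t where "s = val q (drop_digits (Suc n) d)" and "t = val q (drop_digits (Suc n) e)"
  have eq: "real (e n) - real (d n) + t - s = 0"
    using val_diff_at[of d M e M n, OF bd(1,2) lt] bd(3,4) by (simp add: s_def t_def)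
  have t: "0 \<le> t" "t \<le> real M / (q - 1)"
    unfolding t_def using bd by (auto intro!: val_nonneg val_le simp: drop_digits_def)
  consider "d n + 1 \<le> e n" | "e n + 1 \<le> d n" using n by linarith
  then show False
  proof cases
    case 1
    then have "s < 1" using up[of n] bd(2)[of n] by (simp add: s_def)
    then show False using 1 eq t by linarith
  next
    case 2
    then have "real M / (q - 1) - s < 1" using down[of n] by (simp add: s_def)
    then show False using 2 eq t by linarith
  qed
qed

section \<open>Necessary conditions on the tails of a unique expansion\<close>

context
  fixes M x d
  assumes qM: "q \<le> real M + 1" and uniq: "\<exists>!d. is_expansion M q x d" and d: "is_expansion M q x d"
begin

text \<open>Replacing digit \<open>n\<close> by \<open>k\<close> leaves the value \<open>t\<close> for the new tail; if \<open>t\<close> were in the range of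
  values, a second expansion of \<open>x\<close> would arise.\<close>

lemma digit_exchange:
  assumes "k \<le> M" "k \<noteq> d n"
    and t: "t = real (d n) + val q (drop_digits (Suc n) d) - real k"
  shows "t < 0 \<or> real M / (q - 1) < t"
proof (rule ccontr)
  assume "\<not> (t < 0 \<or> real M / (q - 1) < t)"
  then obtain f where f: "is_expansion M q t f" using exists_expansion[OF qM, of t] by auto
  define e where "e i = (if i < n then d i else if i = n then k else f (i - Suc n))" for i
  have bd: "\<And>i. d i \<le> M" "val q d = x" "\<And>i. f i \<le> M" "val q f = t"
    using d f by (auto simp: is_expansion_iff_val)
  have be: "e i \<le> M" for i using assms bd by (simp add: e_def)
  have "drop_digits (Suc n) e = f" by (simp add: drop_digits_def e_def fun_eq_iff)
  then have "(val q e - val q d) * q ^ Suc n = 0"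
    using val_diff_at[of d M e M n, OF bd(1) be] bd t by (simp add: e_def)
  then have "is_expansion M q x e" using be bd q by (simp add: is_expansion_iff_val)
  then have "e = d" using uniq d by auto
  then have "e n = d n" by simp
  then show False using assms(2) by (simp add: e_def)
qed

text \<open>Let v be the value of the tail. If digit n is raised by one, the new tail needs the
  value v - 1, which cannot exceed M / (q - 1) and so must be negative. The mirror statement below
  lowers the digit and needs v + 1, which is never negative.\<close>

lemma univoque_tail_lt: "d n < M \<Longrightarrow> val q (drop_digits (Suc n) d) < 1"
proof -
  assume n: "d n < M"
  have bd: "\<And>i. d i \<le> M" using d by (simp add: is_expansion_iff_val)
  have "val q (drop_digits (Suc n) d) \<le> real M / (q - 1)"
    using bd by (intro val_le) (simp add: drop_digits_def)
  then show ?thesis using digit_exchange[of "Suc (d n)" n, OF _ _ refl] n by auto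
qed

lemma univoque_tail_gt: "0 < d n \<Longrightarrow> real M / (q - 1) - val q (drop_digits (Suc n) d) < 1"
proof -
  assume n: "0 < d n"
  have bd: "\<And>i. d i \<le> M" using d by (simp add: is_expansion_iff_val)
  have "0 \<le> val q (drop_digits (Suc n) d)"
    using bd by (intro val_nonneg) (simp add: drop_digits_def)
  then show ?thesis using digit_exchange[of "d n - 1" n, OF _ _ refl] n bd[of n]
    by (simp add: of_nat_diff) linarith
qed

end

end

section \<open>Counting words with bounded tails\<close>

fun word_val :: "real \<Rightarrow> nat list \<Rightarrow> real" where
  "word_val b [] = 0"
| "word_val b (k # w) = (real k + word_val b w) / b"

lemma word_val_nonneg: "0 < b \<Longrightarrow> 0 \<le> word_val b w"
  by (induction w) auto

text \<open>The bound y on the whole word is kept apart from the bound Y on all suffixes, because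
  cutting off the first letter changes only y.\<close>

definition admissible_words :: "real \<Rightarrow> nat \<Rightarrow> real \<Rightarrow> nat \<Rightarrow> real \<Rightarrow> nat list set" where
  "admissible_words b N Y n y =
     {w. length w = n \<and> set w \<subseteq> {..N} \<and> word_val b w \<le> y \<and> (\<forall>i. word_val b (drop i w) \<le> Y)}"

lemma finite_admissible_words [simp]: "finite (admissible_words b N Y n y)"
  by (rule finite_subset[OF _ finite_lists_length_eq[of "{..N}" n]]) (auto simp: admissible_words_def)

lemma admissible_words_Suc:
  assumes "0 < b"
  shows "admissible_words b N Y (Suc n) y \<subseteq>
    (\<Union>k\<in>{k. k \<le> N \<and> real k \<le> b * y}. (#) k ` admissible_words b N Y n (min Y (b * y - real k)))"
proof
  fix w assume w: "w \<in> admissible_words b N Y (Suc n) y"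
  then obtain k v where kv: "w = k # v" by (auto simp: admissible_words_def length_Suc_conv)
  have suf: "word_val b (drop i v) \<le> Y" for i
  proof -
    have "word_val b (drop (Suc i) w) \<le> Y" using w unfolding admissible_words_def by blast
    then show ?thesis using kv by simp
  qed
  have "(real k + word_val b v) / b \<le> y" using w kv by (simp add: admissible_words_def)
  then have "real k + word_val b v \<le> b * y" using assms by (simp add: field_simps)
  moreover have "0 \<le> word_val b v" using assms by (rule word_val_nonneg)
  moreover have "word_val b v \<le> Y" using suf[of 0] by simp
  ultimately show "w \<in> (\<Union>k\<in>{k. k \<le> N \<and> real k \<le> b * y}. (#) k ` admissible_words b N Y n (min Y (b * y - real k)))"
    using w kv suf by (intro UN_I[of k]) (auto simp: admissible_words_def)
qed

text \<open>This is concavity of z^s: the derivative of the difference is nonpositive because z^(s -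
  1) decreases.\<close>

lemma powr_add_diff_antimono:
  fixes s x y j :: real
  assumes "0 < x" "x \<le> y" "0 \<le> j" "0 < s" "s < 1"
  shows "(j + y) powr s - y powr s \<le> (j + x) powr s - x powr s"
proof (rule DERIV_nonpos_imp_nonincreasing[OF assms(2)])
  fix z assume z: "x \<le> z" "z \<le> y"
  have "((\<lambda>z. (j + z) powr s) has_real_derivative s * (j + z) powr (s - 1)) (at z)"
    using DERIV_fun_powr[of "\<lambda>z. j + z" 1 z s] z assms by (auto intro!: derivative_eq_intros)
  moreover have "((\<lambda>z. z powr s) has_real_derivative s * z powr (s - 1)) (at z)"
    using z assms by (intro has_real_derivative_powr) auto
  ultimately have "((\<lambda>z. (j + z) powr s - z powr s) has_real_derivative
      s * (j + z) powr (s - 1) - s * z powr (s - 1)) (at z)"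
    by (rule DERIV_diff)
  moreover have "(j + z) powr (s - 1) \<le> z powr (s - 1)"
    using z assms by (intro powr_mono2') auto
  ultimately show "\<exists>d. ((\<lambda>z. (j + z) powr s - z powr s) has_real_derivative d) (at z) \<and> d \<le> 0"
    using assms by (auto intro!: exI)
qed

text \<open>The convex function u^p lies below its chord over [1, n + 1].\<close>

lemma convex_powr_chord:
  fixes p x n :: real
  assumes "1 < p" "0 \<le> x" "x \<le> n" "0 < n"
  shows "(x + 1) powr p \<le> 1 + x / n * ((n + 1) powr p - 1)"
proof -
  have "convex_on {0<..} (\<lambda>x::real. x powr p)" using assms by (intro powr_convex) simp
  then have "((1 - x / n) *\<^sub>R 1 + (x / n) *\<^sub>R (n + 1)) powr p \<le> (1 - x / n) * 1 powr p + x / n * (n + 1) powr p"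
    using assms by (intro convex_onD) auto
  moreover have "(1 - x / n) *\<^sub>R 1 + (x / n) *\<^sub>R (n + 1) = x + 1" using assms by (simp add: field_simps)
  ultimately show ?thesis by (simp add: algebra_simps)
qed

text \<open>By concavity the worst case is T = Y, where the claim reads (j + 1)^(1/s) <= 1 + j / Y.
  For j = N this follows from the hypothesis and Y <= Y'; smaller j follow by convexity of
  u^(1/s).\<close>

lemma powr_growth_inequality:
  assumes s: "0 < s" "s < 1" and N: "(real N + 1) powr (1 / s) \<le> 1 + real N / Y'"
    and j: "j \<le> N" "0 < N" and T: "0 < T" "T \<le> Y" "Y \<le> Y'"
  shows "real j * Y powr s + T powr s \<le> (real j + T) powr s"
proof -
  have Y: "0 < Y" "0 < Y'" using T by auto
  have "(real j + 1) powr (1 / s) \<le> 1 + real j / real N * ((real N + 1) powr (1 / s) - 1)"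
    using s j by (intro convex_powr_chord) auto
  also have "\<dots> \<le> 1 + real j / real N * (real N / Y')"
    using N by (intro add_left_mono mult_left_mono) auto
  also have "\<dots> = 1 + real j / Y'" using j by simp
  also have "\<dots> \<le> 1 + real j / Y" using T Y by (intro add_left_mono divide_left_mono) auto
  finally have "((real j + 1) powr (1 / s)) powr s \<le> (1 + real j / Y) powr s"
    using s by (intro powr_mono2) auto
  then have "real j + 1 \<le> (1 + real j / Y) powr s" using s by (simp add: powr_powr)
  then have "(real j + 1) * Y powr s \<le> (1 + real j / Y) powr s * Y powr s"
    by (intro mult_right_mono) auto
  also have "\<dots> = (real j + Y) powr s"
    using Y by (subst powr_mult[symmetric]) (auto simp: distrib_right add.commute)
  finally have "real j * Y powr s \<le> (real j + Y) powr s - Y powr s" by (simp add: algebra_simps)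
  also have "\<dots> \<le> (real j + T) powr s - T powr s" using T s by (intro powr_add_diff_antimono) auto
  finally show ?thesis by simp
qed

text \<open>The estimate is a function of \<open>y\<close> so that it survives the recursion on the first digit. All
  terms but the last have the full tail range \<open>Y\<close>, and the growth inequality absorbs their number;
  \<open>\<eta> / b ^ n\<close> covers the words whose first letter just fits.\<close>

lemma card_admissible_words:
  assumes s: "0 < s" "s < 1" and N: "(real N + 1) powr (1 / s) \<le> 1 + real N / (Y + \<eta>)" "0 < N"
    and b: "1 < b" and \<eta>: "0 < \<eta>" and "0 \<le> y" "y \<le> Y"
  shows "real (card (admissible_words b N Y n y)) \<le> \<eta> powr (- s) * (b powr s) ^ n * (y + \<eta> / b ^ n) powr s"
  using assms(7,8)
proof (induction n arbitrary: y)
  case 0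
  have "admissible_words b N Y 0 y \<subseteq> {[]}" by (auto simp: admissible_words_def)
  then have "card (admissible_words b N Y 0 y) \<le> 1" using card_mono[of "{[] :: nat list}"] by simp
  moreover have "\<eta> powr (- s) * \<eta> powr s \<le> \<eta> powr (- s) * (y + \<eta>) powr s"
    using 0 s \<eta> by (intro mult_left_mono powr_mono2) auto
  moreover have "\<eta> powr (- s) * \<eta> powr s = 1" using \<eta> by (simp flip: powr_add)
  ultimately show ?case by simp
next
  case (Suc n)
  define \<delta> where "\<delta> = \<eta> / b ^ n"
  define A where "A = \<eta> powr (- s) * (b powr s) ^ n"
  \<comment> \<open>The largest first letter that fits. For letters below j only the bound Y on the
    rest is used; for j itself the sharper z below is kept.\<close>
  define j where "j = min N (nat \<lfloor>b * y\<rfloor>)"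
  have by0: "0 \<le> b * y" using b Suc.prems by simp
  have \<delta>: "0 < \<delta>" "\<delta> \<le> \<eta>" using b \<eta> by (auto simp: \<delta>_def field_simps)
  have A: "0 \<le> A" by (simp add: A_def)
  have Y: "0 \<le> Y" using Suc.prems by linarith
  have ks: "{k. k \<le> N \<and> real k \<le> b * y} = {..j}"
    using by0 by (auto simp: j_def le_nat_floor le_nat_iff le_floor_iff)
  have j_le: "real j \<le> b * y" using by0 unfolding j_def by linarith
  define z where "z = min Y (b * y - real j)"
  have z: "0 \<le> z" "z \<le> Y" using Y j_le by (auto simp: z_def)
  have IH: "real (card (admissible_words b N Y n x)) \<le> A * (x + \<delta>) powr s" if "0 \<le> x" "x \<le> Y" for x
    using Suc.IH[OF that] by (simp add: A_def \<delta>_def)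
  have low: "real (card (admissible_words b N Y n (min Y (b * y - real k)))) \<le> A * (Y + \<delta>) powr s"
    if "k < j" for k
  proof -
    have x: "0 \<le> min Y (b * y - real k)" using that j_le Y by auto
    have "A * (min Y (b * y - real k) + \<delta>) powr s \<le> A * (Y + \<delta>) powr s"
      using x A \<delta> s by (intro mult_left_mono powr_mono2) auto
    then show ?thesis using IH[OF x] by simp
  qed
  have "card (admissible_words b N Y (Suc n) y) \<le>
      card (\<Union>k\<in>{..j}. (#) k ` admissible_words b N Y n (min Y (b * y - real k)))"
    using admissible_words_Suc[of b N Y n y] b ks by (intro card_mono) auto
  also have "\<dots> \<le> (\<Sum>k\<in>{..j}. card ((#) k ` admissible_words b N Y n (min Y (b * y - real k))))"
    by (intro card_UN_le) auto
  also have "\<dots> = (\<Sum>k\<in>{..j}. card (admissible_words b N Y n (min Y (b * y - real k))))"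
    by (intro sum.cong card_image) auto
  finally have "real (card (admissible_words b N Y (Suc n) y)) \<le>
      (\<Sum>k\<in>{..j}. real (card (admissible_words b N Y n (min Y (b * y - real k)))))"
    by (simp flip: of_nat_sum)
  also have "\<dots> = (\<Sum>k<j. real (card (admissible_words b N Y n (min Y (b * y - real k))))) +
      real (card (admissible_words b N Y n z))"
    by (simp add: z_def flip: lessThan_Suc_atMost)
  also have "\<dots> \<le> (\<Sum>k<j. A * (Y + \<delta>) powr s) + A * (z + \<delta>) powr s"
    using low z by (intro add_mono sum_mono IH) auto
  also have "\<dots> = A * (real j * (Y + \<delta>) powr s + (z + \<delta>) powr s)"
    by (simp add: algebra_simps)
  \<comment> \<open>The growth inequality is applied with \<open>Y + \<delta>\<close> as its Y,
    \<open>Y + \<eta>\<close> as its Y' and \<open>z + \<delta>\<close> as its T.\<close>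
  also have "\<dots> \<le> A * (real j + (z + \<delta>)) powr s"
    using A s N z \<delta> by (intro mult_left_mono powr_growth_inequality[of s N "Y + \<eta>"]) (auto simp: j_def)
  also have "\<dots> \<le> A * (b * y + \<delta>) powr s"
    using A s z \<delta> by (intro mult_left_mono powr_mono2) (auto simp: z_def)
  \<comment> \<open>Rescaling by b turns the slack for length n into that for length n + 1 and
    produces the growth factor b^s.\<close>
  also have "b * y + \<delta> = b * (y + \<eta> / b ^ Suc n)" using b by (simp add: \<delta>_def field_simps)
  also have "A * (b * (y + \<eta> / b ^ Suc n)) powr s = \<eta> powr (- s) * (b powr s) ^ Suc n * (y + \<eta> / b ^ Suc n) powr s"
    using b Suc.prems \<eta> by (simp add: powr_mult A_def)
  finally show ?case .
qed

text \<open>With p = (N + 1)^(1/s), the condition on s says p < K + 1. So N / (p - 1) exceeds N / K,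
  and eta is the excess; the required inequality then holds with equality.\<close>

lemma critical_exponent:
  assumes N: "0 < N" and c: "0 < c" and K: "K = N + c"
    and s: "ln (real N + 1) / ln (real K + 1) < s"
  obtains \<eta> where "0 < \<eta>" "(real N + 1) powr (1 / s) \<le> 1 + real N / (real N / real K + \<eta>)"
proof -
  define p where "p = (real N + 1) powr (1 / s)"
  have pos: "0 < ln (real N + 1)" "0 < ln (real K + 1)" using N K by auto
  then have s0: "0 < s" by (intro less_trans[OF _ s] divide_pos_pos)
  have "ln (real N + 1) < s * ln (real K + 1)" using s pos by (simp add: pos_divide_less_eq)
  then have "1 / s * ln (real N + 1) < ln (real K + 1)"
    using s0 by (simp add: pos_divide_less_eq mult.commute)
  then have "exp (1 / s * ln (real N + 1)) < exp (ln (real K + 1))" by (simp only: exp_less_cancel_iff)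
  then have p: "p < real K + 1" "1 < p" unfolding p_def powr_def using N s0 by auto
  define \<eta> where "\<eta> = real N / (p - 1) - real N / real K"
  have "real N / real K < real N / (p - 1)"
    using p N K by (intro divide_strict_left_mono) auto
  then have "0 < \<eta>" by (simp add: \<eta>_def)
  moreover have "p \<le> 1 + real N / (real N / real K + \<eta>)" using p N by (simp add: \<eta>_def)
  ultimately show ?thesis using that unfolding p_def by blast
qed

section \<open>Upper bounds\<close>

lemma val_antimono_base:
  assumes "1 < q" "q \<le> b" "\<And>i. d i \<le> M"
  shows "val b d \<le> val q d"
  unfolding val_def
proof (rule suminf_le)
  show "real (d i) / b ^ Suc i \<le> real (d i) / q ^ Suc i" for i
    using assms by (intro divide_left_mono power_mono mult_pos_pos zero_less_power) auto
qed (use assms summable_digits[of _ d M] in simp_all)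

lemma word_val_le_val:
  assumes "1 < b" "\<And>i. e i \<le> M"
  shows "word_val b (map e [n..<n + l]) \<le> val b (drop_digits n e)"
proof (induction l arbitrary: n)
  case 0
  have "drop_digits n e i \<le> M" for i using assms(2) by (simp add: drop_digits_def)
  then show ?case using val_nonneg[OF assms(1), of "drop_digits n e" M] by simp
next
  case (Suc l)
  have "map e [n..<n + Suc l] = e n # map e [Suc n..<Suc n + l]" by (simp add: upt_conv_Cons del: upt_Suc)
  then have "b * word_val b (map e [n..<n + Suc l]) = real (e n) + word_val b (map e [Suc n..<Suc n + l])"
    using assms(1) by simp
  also have "\<dots> \<le> real (e n) + val b (drop_digits (Suc n) e)" using Suc[of "Suc n"] by simp
  also have "\<dots> = b * val b (drop_digits n e)" using val_drop_step[of b e M n] assms by simp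
  finally show ?case using assms(1) by simp
qed

text \<open>Common core of the upper bounds for points and for bases. A code consists of the first m
  digits, which are free, and of the next n digits lowered by c, an admissible word. There are
  O(b^(s n)) codes, each class has diameter O(a^(-n)), and b^s < a^t makes the sums vanish.\<close>

lemma covering_null_restricted_digits:
  fixes dig :: "real \<Rightarrow> nat \<Rightarrow> nat"
  assumes N: "0 < N" "0 < c" "K = N + c" and s: "ln (real N + 1) / ln (real K + 1) < s" "s < 1"
    and a: "1 < a" "1 < b" "b powr s < a powr t" and t: "0 < t" and B: "0 < B"
    and M: "\<And>x i. x \<in> S \<Longrightarrow> dig x i \<le> M"
    and K: "\<And>x i. x \<in> S \<Longrightarrow> m \<le> i \<Longrightarrow> c \<le> dig x i \<and> dig x i \<le> K"
    and tail: "\<And>x n. x \<in> S \<Longrightarrow> m \<le> n \<Longrightarrow> val b (drop_digits n (\<lambda>i. dig x i - c)) \<le> real N / real K"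
    and close: "\<And>x y n. x \<in> S \<Longrightarrow> y \<in> S \<Longrightarrow> \<forall>i<n. dig x i = dig y i \<Longrightarrow> \<bar>x - y\<bar> \<le> B / a ^ n"
  shows "covering_null t S"
proof -
  obtain \<eta> where \<eta>: "0 < \<eta>" "(real N + 1) powr (1 / s) \<le> 1 + real N / (real N / real K + \<eta>)"
    using critical_exponent[OF N s(1)] .
  have s0: "0 < s" using s(1) N by (intro le_less_trans[OF _ s(1)] divide_nonneg_nonneg) auto
  define Y where "Y = real N / real K"
  define F where "F n = {w. set w \<subseteq> {..M} \<and> length w = m} \<times> admissible_words b N Y n Y" for n
  define code where "code n x = (map (dig x) [0..<m], map (\<lambda>i. dig x i - c) [m..<m + n])" for n x
  define D where "D = (real M + 1) ^ m * (\<eta> powr (- s) * (Y + \<eta>) powr s)"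
  have Y0: "0 \<le> Y" by (simp add: Y_def)
  show ?thesis
  proof (rule covering_null_codes[where \<pi> = code and F = F and r = "b powr s" and \<rho> = "1 / a" and B = B and D = D])
    show "finite (F n)" for n by (simp add: F_def finite_lists_length_eq)
    show "real (card (F n)) \<le> D * (b powr s) ^ n" for n
    proof -
      have "real (card (admissible_words b N Y n Y)) \<le> \<eta> powr (- s) * (b powr s) ^ n * (Y + \<eta> / b ^ n) powr s"
        using s0 s \<eta> N a Y0 by (intro card_admissible_words) (auto simp: Y_def)
      also have "\<dots> \<le> \<eta> powr (- s) * (b powr s) ^ n * (Y + \<eta>) powr s"
        using a \<eta> Y0 s0 by (intro mult_left_mono powr_mono2) (auto simp: divide_le_eq)
      finally have "(real M + 1) ^ m * real (card (admissible_words b N Y n Y)) \<le>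
          (real M + 1) ^ m * (\<eta> powr (- s) * (b powr s) ^ n * (Y + \<eta>) powr s)"
        by (intro mult_left_mono) auto
      moreover have "real (card (F n)) = (real M + 1) ^ m * real (card (admissible_words b N Y n Y))"
        by (simp add: F_def card_cartesian_product card_lists_length_eq add.commute)
      ultimately show ?thesis by (simp add: D_def mult_ac)
    qed
    show "code n x \<in> F n" if x: "x \<in> S" for n x
    proof -
      let ?e = "\<lambda>i. dig x i - c"
      have e: "?e i \<le> M" for i using M[OF x, of i] by simp
      have word: "word_val b (map ?e [i..<m + n]) \<le> Y" if "m \<le> i" "i \<le> m + n" for i
        using word_val_le_val[of b ?e M i "m + n - i"] tail[OF x that(1)] a e that by (simp add: Y_def)
      have "word_val b (drop i (map ?e [m..<m + n])) \<le> Y" for i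
      proof (cases "i \<le> n")
        case True
        then show ?thesis using word[of "m + i"] by (simp add: drop_map add.commute)
      next
        case False
        then show ?thesis using Y0 by simp
      qed
      moreover have "set (map ?e [m..<m + n]) \<subseteq> {..N}"
        using K[OF x] N by fastforce
      moreover have "word_val b (map ?e [m..<m + n]) \<le> Y" using word[of m] by simp
      ultimately have "map ?e [m..<m + n] \<in> admissible_words b N Y n Y"
        unfolding admissible_words_def by simp
      then show ?thesis using M[OF x] by (auto simp: F_def code_def)
    qed
    show "\<bar>x - y\<bar> \<le> B * (1 / a) ^ n" if "x \<in> S" "y \<in> S" "code n x = code n y" for n x y
    proof -
      have eq: "dig x i = dig y i" if "i < n" for i
      proof (cases "i < m")
        case True
        then show ?thesis using \<open>code n x = code n y\<close> by (auto simp: code_def list_eq_iff_nth_eq)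
      next
        case False
        \<comment> \<open>Subtraction of naturals truncates, so the lower bound c is what lets equal
          shifted digits imply equal digits.\<close>
        then have "i \<in> set [m..<m + n]" "c \<le> dig x i" "c \<le> dig y i"
          using \<open>i < n\<close> K \<open>x \<in> S\<close> \<open>y \<in> S\<close> by auto
        moreover have "\<forall>i\<in>set [m..<m + n]. dig x i - c = dig y i - c"
          using \<open>code n x = code n y\<close> unfolding code_def prod.inject map_eq_conv by blast
        ultimately show ?thesis by (metis le_add_diff_inverse)
      qed
      then show ?thesis using close[OF that(1,2), of n] by (simp add: power_one_over)
    qed
    have "b powr s * (1 / a) powr t = b powr s / a powr t"
      using a by (simp add: powr_divide)
    also have "\<dots> < 1" using a by simp
    finally show "b powr s * (1 / a) powr t < 1" .
    show "0 < D" unfolding D_def using Y0 \<eta> by (intro mult_pos_pos) auto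
  qed (use a t B in auto)
qed

text \<open>After a digit below M the tail is below 1, so the next digit is below q <= K + 1, hence
  at most K < M, and the argument repeats. Reflection of the digits gives the lower bound c after a
  positive digit. Lowering all digits by c removes c / (q - 1) >= c / K from a tail below 1, which
  leaves at most 1 - c / K = N / K.\<close>

lemma univoque_digits:
  assumes M: "M = N + 2 * c" "K = N + c" "0 < c" "0 < K"
    and q: "1 < q" "q \<le> real K + 1"
    and uniq: "\<exists>!d. is_expansion M q x d" and d: "is_expansion M q x d"
    and m: "\<exists>i<m. d i < M" "\<exists>i<m. 0 < d i" and n: "m \<le> n"
  shows "c \<le> d n" "d n \<le> K" "val q (drop_digits n (\<lambda>i. d i - c)) \<le> real N / real K"
proof -
  have qM: "q \<le> real M + 1" using q M by simp
  have bd: "\<And>i. d i \<le> M" using d q by (simp add: is_expansion_iff_val)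
  have bdd: "drop_digits n d i \<le> M" for n i using bd by (simp add: drop_digits_def)
  note up = univoque_tail_lt[OF q(1) qM uniq d] and down = univoque_tail_gt[OF q(1) qM uniq d]
  have step: "q * val q (drop_digits n d) = real (d n) + val q (drop_digits (Suc n) d)" for n
    using val_drop_step[of q d M n] q bd by simp
  have small: "d (Suc i) \<le> K" if "d i < M" for i
  proof -
    have "real (d (Suc i)) \<le> q * val q (drop_digits (Suc i) d)"
      using step[of "Suc i"] val_nonneg[OF q(1) bdd[of "Suc (Suc i)"]] by simp
    also have "\<dots> < q * 1" using up[OF that] q by (intro mult_strict_left_mono) auto
    finally show ?thesis using q by linarith
  qed
  have large: "c \<le> d (Suc i)" if "0 < d i" for i
  proof -
    \<comment> \<open>The distance of a tail to the maximum M / (q - 1) obeys the same recursion,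
      with the reflected digits M - d.\<close>
    have "q * (real M / (q - 1)) = real M + real M / (q - 1)" using q by (simp add: field_simps)
    then have "real M - real (d (Suc i)) \<le> q * (real M / (q - 1) - val q (drop_digits (Suc i) d))"
      using step[of "Suc i"] val_le[OF q(1) bdd[of "Suc (Suc i)"]] by (simp add: right_diff_distrib)
    also have "\<dots> < q * 1" using down[OF that] q by (intro mult_strict_left_mono) auto
    finally show ?thesis using q M by linarith
  qed
  obtain i j where ij: "i < m" "d i < M" "j < m" "0 < d j" using m by auto
  have lt: "d k < M" if "i \<le> k" for k
    using that
  proof (induction k rule: dec_induct)
    case (step n)
    then show ?case using small[of n] M by simp
  qed (rule ij)
  have gt: "0 < d k" if "j \<le> k" for k
    using that
  proof (induction k rule: dec_induct)
    case (step n)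
    then show ?case using large[of n] M by simp
  qed (rule ij)
  \<comment> \<open>The bounds at k come from the digit before it, which is why m lies beyond both
    witnesses.\<close>
  have K: "d k \<le> K" "c \<le> d k" if "m \<le> k" for k
    using that small[of "k - 1"] large[of "k - 1"] lt[of "k - 1"] gt[of "k - 1"] ij by auto
  from K[OF n] show "c \<le> d n" "d n \<le> K" by auto
  have "drop_digits n (\<lambda>i. d i - c) = (\<lambda>i. drop_digits n d i - c)" by (simp add: drop_digits_def fun_eq_iff)
  moreover have "val q (\<lambda>i. drop_digits n d i - c) = val q (drop_digits n d) - val q (\<lambda>_. c)"
    using K n bdd by (intro val_minus[OF q(1), of _ _ M]) (auto simp: drop_digits_def)
  moreover have "val q (drop_digits n d) < 1" using up[of "n - 1"] lt[of "n - 1"] ij n by simp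
  moreover have "real c / real K \<le> real c / (q - 1)" using q M by (intro divide_left_mono) auto
  moreover have "1 - real c / real K = real N / real K" using M by (simp add: field_simps)
  ultimately show "val q (drop_digits n (\<lambda>i. d i - c)) \<le> real N / real K"
    using val_const[OF q(1), of c] by simp
qed

lemma exists_exponent_between:
  assumes "0 < N" "0 < c" "K = N + c" "ln (real N + 1) / ln (real K + 1) < t"
  obtains s where "ln (real N + 1) / ln (real K + 1) < s" "s < 1" "s < t" "0 < s"
proof -
  have "ln (real N + 1) / ln (real K + 1) < 1" using assms by simp
  then obtain s where s: "ln (real N + 1) / ln (real K + 1) < s" "s < min t 1"
    using assms dense by (metis min_less_iff_conj)
  have "0 \<le> ln (real N + 1) / ln (real K + 1)" by simp
  then have "0 < s" using s(1) by linarith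
  then show ?thesis using that s by auto
qed

lemma covering_null_univoque_set:
  assumes N: "0 < N" "0 < c" "K = N + c" "M = N + 2 * c" and q: "1 < q" "q \<le> real K + 1"
    and t: "ln (real N + 1) / ln (real K + 1) < t"
  shows "covering_null t (univoque_set M q)"
proof -
  obtain s where s: "ln (real N + 1) / ln (real K + 1) < s" "s < 1" "s < t" "0 < s"
    using exists_exponent_between[OF N(1-3) t] .
  define dig where "dig x = (THE d. is_expansion M q x d)" for x
  have dig: "is_expansion M q x (dig x)" "\<exists>!d. is_expansion M q x d" if "x \<in> univoque_set M q" for x
    using that theI'[of "is_expansion M q x"] by (auto simp: univoque_set_def dig_def)
  \<comment> \<open>Before place m both a digit below M and a positive digit have occurred. A point
    in no \<open>S m\<close> has a constant expansion with digit 0 or M and is an endpoint.\<close>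
  define S where "S m = {x \<in> univoque_set M q. (\<exists>i<m. dig x i < M) \<and> (\<exists>i<m. 0 < dig x i)}" for m
  have "covering_null t (S m)" for m
  proof (rule covering_null_restricted_digits[OF N(1-3) s(1,2), where a = q and b = q and dig = dig and M = M
        and B = "real M / (q - 1)" and m = m])
    fix x y n assume x: "x \<in> S m" and y: "y \<in> S m" and eq: "\<forall>i<n. dig x i = dig y i"
    have bd: "\<And>i. dig x i \<le> M" "\<And>i. dig y i \<le> M" "val q (dig x) = x" "val q (dig y) = y"
      using dig[of x] dig[of y] x y q by (auto simp: S_def is_expansion_iff_val)
    let ?u = "val q (drop_digits n (dig x))" and ?v = "val q (drop_digits n (dig y))"
    have "x - y = (?u - ?v) / q ^ n"
      using val_split[of q "dig x" M n] val_split[of q "dig y" M n] q bd eq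
      by (simp add: diff_divide_distrib)
    moreover have "0 \<le> ?u" "?u \<le> real M / (q - 1)" "0 \<le> ?v" "?v \<le> real M / (q - 1)"
      using bd q by (auto intro!: val_nonneg val_le simp: drop_digits_def)
    ultimately show "\<bar>x - y\<bar> \<le> real M / (q - 1) / q ^ n"
      using q by (auto simp: abs_divide intro!: divide_right_mono simp del: divide_divide_eq_left)
  next
    show "q powr s < q powr t" using q s by simp
    fix x n assume x: "x \<in> S m"
    then have x': "x \<in> univoque_set M q" and m: "\<exists>i<m. dig x i < M" "\<exists>i<m. 0 < dig x i"
      by (auto simp: S_def)
    show "dig x n \<le> M" using dig(1)[OF x'] by (simp add: is_expansion_def)
    assume n: "m \<le> n"
    have "0 < K" using N by simp
    note D = univoque_digits[OF N(4,3,2) this q dig(2,1)[OF x'] m n]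
    then show "c \<le> dig x n \<and> dig x n \<le> K" by simp
    show "val q (drop_digits n (\<lambda>i. dig x i - c)) \<le> real N / real K" by (rule D)
  qed (use q s N in auto)
  then have "covering_null t (\<Union>m. S m)" by (intro covering_null_countable_UN) auto
  moreover have "covering_null t {0, real M / (q - 1)}" using s by (intro covering_null_countable) auto
  ultimately have "covering_null t (\<Union>b\<in>UNIV. if b then \<Union>m. S m else {0, real M / (q - 1)})"
    by (intro covering_null_countable_UN) auto
  moreover have "univoque_set M q \<subseteq> (\<Union>b\<in>UNIV. if b then \<Union>m. S m else {0, real M / (q - 1)})"
  proof
    fix x assume x: "x \<in> univoque_set M q"
    have bd: "\<And>i. dig x i \<le> M" "val q (dig x) = x" using dig(1)[OF x] q by (auto simp: is_expansion_iff_val)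
    consider "dig x = (\<lambda>_. M)" | "dig x = (\<lambda>_. 0)" | i j where "dig x i < M" "0 < dig x j"
      using bd(1) by (metis ext gr0I le_neq_implies_less)
    then show "x \<in> (\<Union>b\<in>UNIV. if b then \<Union>m. S m else {0, real M / (q - 1)})"
    proof cases
      case 1
      then show ?thesis using bd(2) val_const[OF q(1), of M] by (intro UN_I[of False]) auto
    next
      case 2
      then show ?thesis using bd(2) val_const[OF q(1), of 0] by (intro UN_I[of False]) auto
    next
      case 3
      have "\<exists>k<Suc (max i j). dig x k < M" using 3 by (intro exI[of _ i]) simp
      moreover have "\<exists>k<Suc (max i j). 0 < dig x k" using 3 by (intro exI[of _ j]) simp
      ultimately have "x \<in> S (Suc (max i j))" using x by (simp add: S_def)
      then show ?thesis by (intro UN_I[of True]) auto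
    qed
  qed
  ultimately show ?thesis by (rule covering_null_subset)
qed

text \<open>Nearby bases are treated together: \<open>b\<close> enters the count of words and \<open>a\<close> the distance of bases
  with a common prefix.\<close>

lemma rational_window:
  assumes "0 < s" "s < t" "1 < (q::real)"
  obtains a b where "a \<in> \<rat>" "b \<in> \<rat>" "1 < a" "a \<le> q" "q \<le> b" "b powr s < a powr t"
proof -
  \<comment> \<open>With theta = (t - s) / (s + t), the exponents s (1 + theta) and t (1 - theta)
    agree, so (q r)^s = (q / r)^t; taking a and b strictly inside gives the strict
    inequality.\<close>
  define r where "r = q powr ((t - s) / (s + t))"
  have e: "0 < (t - s) / (s + t)" "(t - s) / (s + t) < 1" using assms by (auto simp: field_simps)
  have r: "1 < r" using assms e by (simp add: r_def)
  have "q / r < q" "q < q * r" "1 < q / r"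
  proof -
    show "q / r < q" "q < q * r" using r assms by (auto simp: field_simps)
    have "r < q powr 1" unfolding r_def using assms e by (intro powr_less_mono) auto
    then show "1 < q / r" using assms r by simp
  qed
  then obtain a b where ab: "a \<in> \<rat>" "b \<in> \<rat>" "q / r < a" "a < q" "q < b" "b < q * r"
    using Rats_dense_in_real by metis
  have "b powr s < (q * r) powr s" using ab assms by (intro powr_less_mono2) auto
  also have "(q * r) powr s = q powr (s * (1 + (t - s) / (s + t)))"
    using assms by (simp add: r_def powr_mult powr_powr powr_add[symmetric] algebra_simps)
  also have "s * (1 + (t - s) / (s + t)) = t * (1 - (t - s) / (s + t))"
    using assms by (simp add: field_simps)
  also have "q powr (t * (1 - (t - s) / (s + t))) = (q / r) powr t"
    using assms by (simp add: r_def powr_divide powr_powr powr_diff[symmetric] algebra_simps)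
  also have "(q / r) powr t < a powr t" using ab assms r by (intro powr_less_mono2) auto
  finally show ?thesis using that[of a b] ab \<open>1 < q / r\<close> by simp
qed

lemma covering_null_univoque_bases:
  assumes N: "0 < N" "0 < c" "K = N + c" "M = N + 2 * c"
    and t: "ln (real N + 1) / ln (real K + 1) < t"
  shows "covering_null t (univoque_bases M \<inter> {..real K + 1})"
proof -
  obtain s where s: "ln (real N + 1) / ln (real K + 1) < s" "s < 1" "s < t" "0 < s"
    using exists_exponent_between[OF N(1-3) t] .
  define U where "U = univoque_bases M \<inter> {..real K + 1}"
  define dig where "dig q = (THE d. is_expansion M q 1 d)" for q
  have U: "is_expansion M q 1 (dig q)" "\<exists>!d. is_expansion M q 1 d" "1 < q" "q \<le> real K + 1" "q \<le> real M + 1"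
    "\<And>i. dig q i \<le> M" "val q (dig q) = 1" if "q \<in> U" for q
  proof -
    show 1: "\<exists>!d. is_expansion M q 1 d" "1 < q" "q \<le> real K + 1" "q \<le> real M + 1"
      using that by (auto simp: U_def univoque_bases_def)
    then show "is_expansion M q 1 (dig q)" using theI'[of "is_expansion M q 1"] by (simp add: dig_def)
    then show "\<And>i. dig q i \<le> M" "val q (dig q) = 1" using is_expansion_iff_val[OF 1(2)] by auto
  qed
  \<comment> \<open>A first digit 0 would make q a tail below 1. A positive first digit has a
    positive tail after it, so it is below q <= K + 1 <= M. Hence m = 1 works below and no
    exceptional bases remain.\<close>
  have first: "0 < dig q 0" "dig q 0 < M" if q: "q \<in> U" for q
  proof -
    note U = U[OF q]
    have step: "q = real (dig q 0) + val q (drop_digits (Suc 0) (dig q))"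
      using val_drop_step[of q "dig q" M 0, OF U(3,6)] U(7) by simp
    show "0 < dig q 0"
    proof (rule ccontr)
      assume "\<not> 0 < dig q 0"
      then show False using step univoque_tail_lt[OF U(3,5,2,1), of 0] U(3) N by simp
    qed
    then have "real M / (q - 1) - val q (drop_digits (Suc 0) (dig q)) < 1"
      by (rule univoque_tail_gt[OF U(3,5,2,1)])
    moreover have "1 < real M / (q - 1)" using U(3,4) N by (simp add: less_divide_eq)
    ultimately show "dig q 0 < M" using step U(4) N by linarith
  qed
  define A where "A a b = U \<inter> {a..b}" for a b :: real
  have null: "covering_null t (A a b)" if ab: "1 < a" "b powr s < a powr t" for a b
  proof (cases "a \<le> b")
    case False
    then show ?thesis using s by (intro covering_null_countable) (auto simp: A_def)
  next
    case True
    have digits: "c \<le> dig q n \<and> dig q n \<le> K" "val b (drop_digits n (\<lambda>i. dig q i - c)) \<le> real N / real K"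
      if q: "q \<in> A a b" and n: "1 \<le> n" for q n
    proof -
      have "q \<in> U" "q \<le> b" using q by (auto simp: A_def)
      note U = U[OF this(1)] and first = first[OF this(1)]
      have "0 < K" using N by simp
      note D = univoque_digits[OF N(4,3,2) this U(3,4,2,1) _ _ n]
      have D: "c \<le> dig q n" "dig q n \<le> K" "val q (drop_digits n (\<lambda>i. dig q i - c)) \<le> real N / real K"
        by (rule D; use first in auto)+
      then show "c \<le> dig q n \<and> dig q n \<le> K" by simp
      have "drop_digits n (\<lambda>i. dig q i - c) i \<le> M" for i
        using U(6)[of "n + i"] by (simp add: drop_digits_def)
      \<comment> \<open>A larger base only lowers the tails, so the admissible words in base b serve
        every q in the window.\<close>
      then have "val b (drop_digits n (\<lambda>i. dig q i - c)) \<le> val q (drop_digits n (\<lambda>i. dig q i - c))"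
        using val_antimono_base[OF U(3) \<open>q \<le> b\<close>] by blast
      then show "val b (drop_digits n (\<lambda>i. dig q i - c)) \<le> real N / real K" using D by simp
    qed
    have close: "p - q \<le> (real K + 1)\<^sup>2 * (real M / (a - 1)) / a ^ n"
      if pq: "p \<in> A a b" "q \<in> A a b" "\<forall>i<n. dig p i = dig q i" "q \<le> p" for p q n
    proof (cases n)
      case 0
      have p: "p \<le> real K + 1" "p \<in> U" and q: "1 < q" "q \<in> U" "a \<le> q"
        using pq U[of p] U[of q] by (auto simp: A_def)
      have "a - 1 \<le> real K" using p pq by (auto simp: A_def)
      moreover have "real K \<le> real M" using N by simp
      ultimately have "1 \<le> real M / (a - 1)" using ab by simp
      moreover have "p - q \<le> (real K + 1)\<^sup>2" using p q by (simp add: power2_eq_square algebra_simps) (smt (verit) mult_nonneg_nonneg of_nat_0_le_iff)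
      ultimately have "(p - q) * 1 \<le> (real K + 1)\<^sup>2 * (real M / (a - 1))"
        by (intro mult_mono) auto
      then show ?thesis using 0 by simp
    next
      case (Suc n')
      have p: "p \<in> U" "a \<le> p" and q: "q \<in> U" "a \<le> q" using pq by (auto simp: A_def)
      note Up = U[OF p(1)] and Uq = U[OF q(1)]
      let ?u = "val p (drop_digits n (dig p))" and ?v = "val q (drop_digits n (dig q))"
      \<comment> \<open>Both bases give the value 1, so what the common prefix gains in the smaller
        base is a difference of tails. As the first digit is at least 1, the term at 0 alone bounds
        1 / q - 1 / p.\<close>
      define h where "h i = real (dig q i) / q ^ Suc i - real (dig q i) / p ^ Suc i" for i
      have h: "0 \<le> h i" for i
        unfolding h_def using pq Uq(3) by (simp add: divide_left_mono mult_mono power_mono)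
      have "1 / q - 1 / p \<le> h 0"
      proof -
        have "1 * (1 / q - 1 / p) \<le> real (dig q 0) * (1 / q - 1 / p)"
          using first[OF q(1)] pq(4) Uq(3) by (intro mult_right_mono) (auto simp: frac_le)
        then show ?thesis by (simp add: h_def right_diff_distrib)
      qed
      also have "h 0 \<le> (\<Sum>i<n. h i)" using h Suc by (intro member_le_sum) auto
      also have "\<dots> = ?u / p ^ n - ?v / q ^ n"
      proof -
        have "(\<Sum>i<n. real (dig p i) / p ^ Suc i) = (\<Sum>i<n. real (dig q i) / p ^ Suc i)"
          using pq(3) by (intro sum.cong) auto
        then show ?thesis
          using val_split[of p "dig p" M n, OF Up(3,6)] val_split[of q "dig q" M n, OF Uq(3,6)] Up(7) Uq(7)
          by (simp add: h_def sum_subtractf)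
      qed
      also have "\<dots> \<le> ?u / p ^ n"
        using Uq by (auto intro!: divide_nonneg_nonneg val_nonneg[of q _ M] simp: drop_digits_def)
      also have "\<dots> \<le> (real M / (p - 1)) / p ^ n"
        using Up by (intro divide_right_mono val_le) (auto simp: drop_digits_def)
      also have "\<dots> \<le> (real M / (a - 1)) / a ^ n"
        using p ab by (intro frac_le divide_left_mono power_mono) auto
      finally have "(p - q) / (q * p) \<le> (real M / (a - 1)) / a ^ n"
        using Up(3) Uq(3) by (simp add: diff_frac_eq)
      \<comment> \<open>Passing from reciprocals to bases costs the factor q p, at most (K +
        1)^2.\<close>
      then have "p - q \<le> (real M / (a - 1)) / a ^ n * (q * p)"
        using Up(3) Uq(3) by (simp add: pos_divide_le_eq)
      also have "\<dots> \<le> (real M / (a - 1)) / a ^ n * (real K + 1)\<^sup>2"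
        using Up Uq ab unfolding power2_eq_square by (intro mult_left_mono mult_mono) auto
      finally show ?thesis by (simp add: mult_ac)
    qed
    show ?thesis
    proof (rule covering_null_restricted_digits[OF N(1-3) s(1,2), where a = a and b = b and dig = dig and M = M
          and B = "(real K + 1)\<^sup>2 * (real M / (a - 1))" and m = 1])
      show "dig p n \<le> M" if "p \<in> A a b" for p n using U(6) that by (simp add: A_def)
      fix p q n assume "p \<in> A a b" "q \<in> A a b" "\<forall>i<n. dig p i = dig q i"
      then show "\<bar>p - q\<bar> \<le> (real K + 1)\<^sup>2 * (real M / (a - 1)) / a ^ n"
        using close[of p q n] close[of q p n] by (cases "q \<le> p") auto
    qed (use ab True s N digits in auto)
  qed
  define I where "I = {(a, b). a \<in> \<rat> \<and> b \<in> \<rat> \<and> 1 < a \<and> b powr s < a powr t}"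
  have "I \<subseteq> \<rat> \<times> \<rat>" by (auto simp: I_def)
  then have "countable I" by (rule countable_subset) (intro countable_SIGMA countable_rat)
  then have "covering_null t (\<Union>i\<in>I. A (fst i) (snd i))"
    by (rule covering_null_countable_UN) (auto simp: I_def intro: null)
  moreover have "U \<subseteq> (\<Union>i\<in>I. A (fst i) (snd i))"
  proof
    fix q assume q: "q \<in> U"
    obtain a b where "a \<in> \<rat>" "b \<in> \<rat>" "1 < a" "a \<le> q" "q \<le> b" "b powr s < a powr t"
      using rational_window[OF s(4,3) U(3)[OF q]] .
    then show "q \<in> (\<Union>i\<in>I. A (fst i) (snd i))"
      using q by (intro UN_I[of "(a, b)"]) (auto simp: I_def A_def)
  qed
  ultimately show ?thesis unfolding U_def[symmetric] by (rule covering_null_subset)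
qed

section \<open>Lower bounds\<close>

definition radix_digit :: "nat \<Rightarrow> real \<Rightarrow> nat \<Rightarrow> nat" where
  "radix_digit B t n = nat (\<lfloor>real B ^ Suc n * t\<rfloor> mod int B)"

lemma radix_digit_less: "0 < B \<Longrightarrow> radix_digit B t n < B"
  by (simp add: radix_digit_def nat_less_iff)

lemma radix_digit_floor_cong:
  assumes "0 < B" "t \<in> {0..<1}" "u \<in> {0..<1}" "\<forall>i<n. radix_digit B t i = radix_digit B u i"
  shows "\<lfloor>real B ^ n * t\<rfloor> = \<lfloor>real B ^ n * u\<rfloor>"
  using assms(4)
proof (induction n)
  case 0
  have "\<lfloor>x\<rfloor> = 0" if "x \<in> {0..<1}" for x :: real using that by (simp add: floor_eq_iff)
  then show ?case using assms by simp
next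
  case (Suc n)
  have step: "\<lfloor>real B ^ Suc n * x\<rfloor> = int B * \<lfloor>real B ^ n * x\<rfloor> + int (radix_digit B x n)" for x
  proof -
    have "\<lfloor>real B ^ n * x\<rfloor> = \<lfloor>real B ^ Suc n * x\<rfloor> div int B"
      using floor_divide_real_eq_div[of "int B" "real B ^ Suc n * x"] assms(1) by simp
    then show ?thesis using assms(1) by (simp add: radix_digit_def)
  qed
  show ?case using Suc by (simp only: step) simp
qed

lemma radix_digit_dist:
  assumes "0 < B" "t \<in> {0..<1}" "u \<in> {0..<1}" "\<forall>i<n. radix_digit B t i = radix_digit B u i"
  shows "\<bar>t - u\<bar> \<le> 1 / real B ^ n"
proof -
  have "\<bar>real B ^ n * t - real B ^ n * u\<bar> \<le> 1"
    using radix_digit_floor_cong[OF assms] by linarith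
  then have "real B ^ n * \<bar>t - u\<bar> \<le> 1" by (simp add: abs_mult flip: right_diff_distrib)
  then show ?thesis using assms(1) by (simp add: field_simps)
qed

text \<open>The family is indexed by t in [0,1) through base-B digits. If those of t and u first
  differ at n, their distance is at most B^(-n) = (beta^(-n))^tau, because beta^tau = B for tau = ln
  B / ln beta. So separation is an inverse Hoelder condition.\<close>

lemma not_covering_null_digit_family:
  fixes g :: "(nat \<Rightarrow> nat) \<Rightarrow> real" and B :: nat
  assumes B: "2 \<le> B" and \<beta>: "1 < \<beta>" and \<kappa>: "0 < \<kappa>"
    and maps: "\<And>v. (\<And>i. v i < B) \<Longrightarrow> g v \<in> A"
    and separated: "\<And>v w n. (\<And>i. v i < B) \<Longrightarrow> (\<And>i. w i < B) \<Longrightarrow> v n \<noteq> w n \<Longrightarrow>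
        \<kappa> / \<beta> ^ n \<le> \<bar>g v - g w\<bar>"
  shows "\<not> covering_null (ln (real B) / ln \<beta>) A"
proof (rule not_covering_null_hoelder[where g = "\<lambda>t. g (radix_digit B t)"])
  define \<tau> where "\<tau> = ln (real B) / ln \<beta>"
  have B0: "0 < B" using B by simp
  have \<tau>: "0 < \<tau>" using B \<beta> by (simp add: \<tau>_def)
  have \<beta>\<tau>: "\<beta> powr \<tau> = real B" using \<beta> B by (simp add: \<tau>_def powr_def)
  show "g (radix_digit B t) \<in> A" for t by (rule maps) (rule radix_digit_less[OF B0])
  show "0 < 1 / \<kappa> powr \<tau>" "0 < ln (real B) / ln \<beta>" using \<kappa> \<tau> by (auto simp: \<tau>_def)
  fix t u :: real assume t: "t \<in> {0..<1}" and u: "u \<in> {0..<1}"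
  let ?v = "radix_digit B t" and ?w = "radix_digit B u"
  show "\<bar>t - u\<bar> \<le> 1 / \<kappa> powr \<tau> * \<bar>g ?v - g ?w\<bar> powr (ln (real B) / ln \<beta>)"
  proof (cases "\<exists>n. ?v n \<noteq> ?w n")
    case True
    define n where "n = (LEAST n. ?v n \<noteq> ?w n)"
    have n: "?v n \<noteq> ?w n" unfolding n_def using True by (rule LeastI_ex)
    have "\<forall>i<n. ?v i = ?w i" unfolding n_def using not_less_Least by blast
    then have "\<bar>t - u\<bar> \<le> 1 / real B ^ n" by (rule radix_digit_dist[OF B0 t u])
    also have "\<dots> = 1 / \<kappa> powr \<tau> * (\<kappa> / \<beta> ^ n) powr \<tau>"
    proof -
      have "(\<beta> ^ n) powr \<tau> = real B ^ n"
        using \<beta> by (simp add: \<beta>\<tau>[symmetric] powr_powr powr_realpow[symmetric] mult.commute)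
      then show ?thesis using \<kappa> \<beta> by (simp add: powr_divide)
    qed
    also have "\<dots> \<le> 1 / \<kappa> powr \<tau> * \<bar>g ?v - g ?w\<bar> powr \<tau>"
      using separated[of ?v ?w n] n \<tau> \<kappa> \<beta> radix_digit_less[OF B0]
      by (intro mult_left_mono powr_mono2) auto
    finally show ?thesis by (simp add: \<tau>_def)
  next
    case False
    have le: "\<bar>t - u\<bar> \<le> (1 / real B) ^ n" for n
      using radix_digit_dist[OF B0 t u, of n] False by (simp add: power_one_over)
    have "(\<lambda>n. (1 / real B) ^ n) \<longlonglongrightarrow> 0" using B by (intro LIMSEQ_realpow_zero) auto
    then have "\<bar>t - u\<bar> \<le> 0" by (rule LIMSEQ_le_const) (use le in blast)
    moreover have "0 \<le> 1 / \<kappa> powr \<tau> * \<bar>g ?v - g ?w\<bar> powr (ln (real B) / ln \<beta>)" by simp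
    ultimately show ?thesis by (rule order_trans)
  qed
qed

lemma radix_ext:
  fixes x y b :: nat
  assumes "x < b ^ k" "y < b ^ k" "\<And>j. j < k \<Longrightarrow> x div b ^ j mod b = y div b ^ j mod b"
  shows "x = y"
  using assms
proof (induction k arbitrary: x y)
  case (Suc k)
  have "x div b = y div b"
  proof (rule Suc.IH)
    show "x div b < b ^ k" "y div b < b ^ k"
      using Suc.prems(1,2) by (auto simp: less_mult_imp_div_less mult.commute)
    show "x div b div b ^ j mod b = y div b div b ^ j mod b" if "j < k" for j
      using Suc.prems(3)[of "Suc j"] that by (simp add: div_mult2_eq)
  qed
  moreover have "x mod b = y mod b" using Suc.prems(3)[of 0] by simp
  ultimately show ?case by (metis div_mult_mod_eq)
qed simp

text \<open>The difference is largest when all digits are M, where geometric series give M (p - q) /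
  ((q - 1) (p - 1)).\<close>

lemma val_lipschitz:
  assumes "1 < a" "a \<le> q" "q \<le> p" "\<And>i. d i \<le> (M::nat)"
  shows "val q d - val p d \<le> real M / (a - 1)\<^sup>2 * (p - q)"
proof -
  have q: "1 < q" "1 < p" using assms by auto
  have pw: "0 \<le> 1 / q ^ Suc i - 1 / p ^ Suc i" for i
    using q assms by (simp add: frac_le mult_mono power_mono)
  have s: "(\<lambda>i. real M / q ^ Suc i - real M / p ^ Suc i) sums (real M / (q - 1) - real M / (p - 1))"
    using q by (intro sums_diff sums_constant_digit)
  have sd: "(\<lambda>i. real (d i) / q ^ Suc i - real (d i) / p ^ Suc i) sums (val q d - val p d)"
    unfolding val_def using q assms(4) by (intro sums_diff summable_sums summable_digits)
  have "val q d - val p d \<le> real M / (q - 1) - real M / (p - 1)"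
  proof (rule sums_le[OF _ sd s])
    fix i
    have "real (d i) * (1 / q ^ Suc i - 1 / p ^ Suc i) \<le> real M * (1 / q ^ Suc i - 1 / p ^ Suc i)"
      using assms(4) pw by (intro mult_right_mono) auto
    then show "real (d i) / q ^ Suc i - real (d i) / p ^ Suc i \<le> real M / q ^ Suc i - real M / p ^ Suc i"
      by (simp add: right_diff_distrib)
  qed
  also have "\<dots> = real M * (p - q) / ((q - 1) * (p - 1))" using q by (simp add: field_simps)
  also have "\<dots> \<le> real M * (p - q) / (a - 1)\<^sup>2"
    unfolding power2_eq_square using assms by (intro divide_left_mono mult_mono) auto
  finally show ?thesis by simp
qed

lemma continuous_on_val:
  assumes "1 < a" "\<And>i. d i \<le> (M::nat)"
  shows "continuous_on {a..b} (\<lambda>q. val q d)"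
proof (rule lipschitz_on_continuous_on)
  have le: "\<bar>val p d - val q d\<bar> \<le> real M / (a - 1)\<^sup>2 * \<bar>p - q\<bar>" if "a \<le> q" "q \<le> p" for p q
    using val_lipschitz[of a q p d M] val_antimono_base[of q p d M] assms that by simp
  show "(real M / (a - 1)\<^sup>2)-lipschitz_on {a..b} (\<lambda>q. val q d)"
  proof (rule lipschitz_onI)
    fix p q assume "p \<in> {a..b}" "q \<in> {a..b}"
    then show "dist (val p d) (val q d) \<le> real M / (a - 1)\<^sup>2 * dist p q"
      using le[of p q] le[of q p] by (cases "q \<le> p") (auto simp: dist_real_def abs_minus_commute)
  qed simp
qed

text \<open>Cut just behind a digit below K, at distance j < l. Its deficit q^(-(j+1)) pays for a
  following tail of value up to 1. Any excess of that tail over 1 shrinks by at least a factor q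
  with each cut, so the crude bound E improves to the claim in the limit.\<close>

lemma val_le_of_windows:
  assumes q: "1 < q" and d: "\<And>i. d i \<le> K"
    and window: "\<And>n. m \<le> n \<Longrightarrow> \<exists>j<l. d (n + j) < K"
    and W: "(\<Sum>i<l. real K / q ^ Suc i) \<le> 1 - \<kappa>" and \<kappa>: "0 \<le> \<kappa>" "\<kappa> \<le> 1" and n: "m \<le> n"
  shows "val q (drop_digits n d) \<le> 1 - \<kappa>"
proof -
  define E where "E = real K / (q - 1)"
  have E: "0 \<le> E" using q by (simp add: E_def)
  have dd: "drop_digits n d i \<le> K" for n i using d by (simp add: drop_digits_def)
  have approx: "val q (drop_digits n d) \<le> 1 - \<kappa> + E / q ^ k" if "m \<le> n" for k n
    using that
  proof (induction k arbitrary: n)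
    case 0
    have "val q (drop_digits n d) \<le> E" unfolding E_def using q dd by (rule val_le)
    then show ?case using \<kappa> by simp
  next
    case (Suc k)
    obtain j where j: "j < l" "d (n + j) < K" using window[OF Suc.prems] by auto
    have split: "val q (drop_digits n d) =
        (\<Sum>i<Suc j. real (d (n + i)) / q ^ Suc i) + val q (drop_digits (n + Suc j) d) / q ^ Suc j"
      using val_split[of q "drop_digits n d" K "Suc j", OF q dd] by (simp add: drop_digits_def[of n d])
    have "(\<Sum>i<j. real (d (n + i)) / q ^ Suc i) \<le> (\<Sum>i<j. real K / q ^ Suc i)"
      using q d by (intro sum_mono divide_right_mono) auto
    moreover have "real (d (n + j)) / q ^ Suc j \<le> (real K - 1) / q ^ Suc j"
      using q j by (intro divide_right_mono) auto
    ultimately have "(\<Sum>i<Suc j. real (d (n + i)) / q ^ Suc i) \<le> (\<Sum>i<Suc j. real K / q ^ Suc i) - 1 / q ^ Suc j"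
      by (simp add: diff_divide_distrib)
    also have "(\<Sum>i<Suc j. real K / q ^ Suc i) \<le> (\<Sum>i<l. real K / q ^ Suc i)"
      using q j by (intro sum_mono2) auto
    finally have "val q (drop_digits n d) \<le> 1 - \<kappa> + (val q (drop_digits (n + Suc j) d) - 1) / q ^ Suc j"
      using W split by (simp add: diff_divide_distrib)
    also have "(val q (drop_digits (n + Suc j) d) - 1) / q ^ Suc j \<le> (E / q ^ k) / q ^ Suc j"
      using Suc.IH[of "n + Suc j"] Suc.prems q \<kappa> by (intro divide_right_mono) auto
    also have "\<dots> \<le> (E / q ^ k) / q"
      using q E self_le_power[of q "Suc j"] by (intro divide_left_mono) auto
    finally show ?case by (simp add: mult.commute)
  qed
  have "(\<lambda>k. 1 - \<kappa> + E * (1 / q) ^ k) \<longlonglongrightarrow> 1 - \<kappa> + E * 0"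
    using q by (intro tendsto_intros LIMSEQ_realpow_zero) auto
  then have "(\<lambda>k. 1 - \<kappa> + E / q ^ k) \<longlonglongrightarrow> 1 - \<kappa>" by (simp add: power_one_over)
  then show ?thesis by (rule LIMSEQ_le_const) (use approx[OF n] in blast)
qed

text \<open>Here c = M - K and N = 2 K - M. With l >= 3 a block has room for a free digit beside the
  two marks c and K.\<close>

locale block_layout =
  fixes N c K M l :: nat
  assumes N: "0 < N" and K: "K = N + c" and M: "M = N + 2 * c" and l: "3 \<le> l"
begin

text \<open>Block \<open>n + 1\<close> (of length \<open>l\<close>) consists of \<open>c\<close>, \<open>K\<close> and the base-\<open>(N + 1)\<close> digits of \<open>v n\<close> shifted by
  \<open>c\<close>. The initial block of digits \<open>K\<close> makes a base with value 1 lie near \<open>K + 1\<close>.\<close>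

definition layout :: "(nat \<Rightarrow> nat) \<Rightarrow> nat \<Rightarrow> nat" where
  "layout v i = (if i < l \<or> i mod l = 1 then K else if i mod l = 0 then c
     else c + v (i div l - 1) div (N + 1) ^ (i mod l - 2) mod (N + 1))"

text \<open>A lower bound for the contribution of the digit K at place l + 1 in any base in (1, K +
  1]; l leading digits K will stay this far below 1.\<close>

definition gap :: real where
  "gap = 1 / (real K + 1) ^ (l + 2)"

lemma c_less_K: "c < K" and M_eq: "M = K + c"
  using N K M by auto

lemma gap: "0 < gap" "gap \<le> 1"
  using one_le_power[of "real K + 1" "l + 2"] by (simp_all add: gap_def divide_le_eq)

lemma layout_bounds: "c \<le> layout v i" "layout v i \<le> K" "layout v i \<le> M"
proof -
  have "c + x mod (N + 1) \<le> K" for x using mod_less_divisor[of "N + 1" x] K by simp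
  then show "c \<le> layout v i" "layout v i \<le> K" using c_less_K by (auto simp: layout_def)
  then show "layout v i \<le> M" using M_eq by simp
qed

lemma layout_window_low:
  assumes "1 \<le> n"
  shows "\<exists>j<l. layout v (n + j) < K"
proof -
  \<comment> \<open>The first multiple of l from n on. For n >= 1 it is at least l, so it carries c
    and not an initial K.\<close>
  define p where "p = l * ((n + l - 1) div l)"
  have "p + (n + l - 1) mod l = n + l - 1" unfolding p_def by simp
  moreover have "(n + l - 1) mod l < l" using l by simp
  ultimately have p: "n \<le> p" "p < n + l" using l by linarith+
  have "l * 1 \<le> p" unfolding p_def using assms l by (intro mult_le_mono2) (simp add: Suc_le_eq div_greater_zero_iff)
  then have "layout v p = c" using l by (simp add: layout_def p_def del: mult_Suc)
  then show ?thesis using p c_less_K by (intro exI[of _ "p - n"]) auto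
qed

lemma layout_window_high: "\<exists>j<l. c < layout v (n + j)"
proof (cases "n < l")
  case True
  then show ?thesis using l c_less_K by (intro exI[of _ 0]) (auto simp: layout_def)
next
  case False
  \<comment> \<open>Chosen so that p + 1 is the first place from n on that is congruent to 1 modulo
    l.\<close>
  define p where "p = l * ((n + l - 2) div l)"
  have "p + (n + l - 2) mod l = n + l - 2" unfolding p_def by simp
  moreover have "(n + l - 2) mod l < l" using l by simp
  ultimately have p: "n \<le> p + 1" "p + 1 < n + l" using l by linarith+
  have "(p + 1) mod l = 1" using l mod_mult_self2[of 1 l "(n + l - 2) div l"] by (simp add: p_def)
  then have "layout v (p + 1) = K" by (simp add: layout_def)
  then show ?thesis using p c_less_K by (intro exI[of _ "p + 1 - n"]) auto
qed

text \<open>Digit j of \<open>v n\<close> stands at place r in block n + 1, whence the bound l (n +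
  2). The first difference p may come earlier, because earlier symbols or digits may differ
  too.\<close>

lemma layout_separates:
  assumes "v n < (N + 1) ^ (l - 2)" "w n < (N + 1) ^ (l - 2)" "v n \<noteq> w n"
  obtains p where "p < l * (n + 2)" "layout v p \<noteq> layout w p" "\<And>i. i < p \<Longrightarrow> layout v i = layout w i"
proof -
  obtain j where j: "j < l - 2" "v n div (N + 1) ^ j mod (N + 1) \<noteq> w n div (N + 1) ^ j mod (N + 1)"
    using radix_ext[OF assms(1,2)] assms(3) by auto
  define r where "r = l * (n + 1) + (j + 2)"
  have r_eq: "r = (j + 2) + (n + 1) * l" by (simp add: r_def)
  have r: "r div l = n + 1" "r mod l = j + 2" "\<not> r < l"
    using j l div_mult_self1[of l "j + 2" "n + 1"] mod_mult_self1[of "j + 2" "n + 1" l]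
    unfolding r_eq by (simp_all only: div_less mod_less less_diff_conv) (simp_all)
  then have ne: "layout v r \<noteq> layout w r" using j by (simp add: layout_def)
  define p where "p = (LEAST p. layout v p \<noteq> layout w p)"
  have "layout v p \<noteq> layout w p" unfolding p_def using ne by (rule LeastI)
  moreover have "p \<le> r" unfolding p_def using ne by (rule Least_le)
  moreover have "r < l * (n + 2)" using j by (simp add: r_def)
  moreover have "layout v i = layout w i" if "i < p" for i
    using not_less_Least that unfolding p_def by blast
  ultimately show ?thesis using that by (meson le_less_trans)
qed

context
  fixes q :: real
  assumes q: "1 < q" and W: "(\<Sum>i<l. real K / q ^ Suc i) \<le> 1 - gap"
begin

lemma layout_tail_le: "1 \<le> n \<Longrightarrow> val q (drop_digits n (layout v)) \<le> 1 - gap"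
  using layout_bounds(2) layout_window_low gap W q by (intro val_le_of_windows[where m = 1]) auto

text \<open>Tails stay below 1 because windows contain digits below K. For the reflected condition
  the digits M - d are again at most K, and a digit above c in each window makes one of them smaller
  than K.\<close>

lemma layout_univoque:
  "is_expansion M q (val q (layout v)) (layout v)" "\<exists>!d. is_expansion M q (val q (layout v)) d"
proof -
  show e: "is_expansion M q (val q (layout v)) (layout v)"
    using q layout_bounds(3) by (simp add: is_expansion_iff_val)
  show "\<exists>!d. is_expansion M q (val q (layout v)) d"
  proof (rule unique_expansionI[OF q e])
    show "val q (drop_digits (Suc n) (layout v)) < 1" for n
      using layout_tail_le[of "Suc n" v] gap by simp
    fix n
    define r where "r i = M - layout v i" for i
    have "\<exists>j<l. r (i + j) < K" for i
    proof -
      obtain j where "j < l" "c < layout v (i + j)" using layout_window_high[of v i] by auto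
      then show ?thesis using layout_bounds(3)[of v "i + j"] M_eq by (intro exI[of _ j]) (simp add: r_def)
    qed
    moreover have "r i \<le> K" for i using layout_bounds(1)[of v i] M_eq by (simp add: r_def)
    ultimately have "val q (drop_digits (Suc n) r) \<le> 1 - gap"
      using gap W q by (intro val_le_of_windows[where m = 0]) auto
    moreover have "val q (drop_digits (Suc n) r) = val q (\<lambda>_. M) - val q (drop_digits (Suc n) (layout v))"
    proof -
      have "drop_digits (Suc n) r = (\<lambda>i. M - drop_digits (Suc n) (layout v) i)"
        by (simp add: drop_digits_def r_def fun_eq_iff)
      then show ?thesis
        using val_minus[OF q, of "drop_digits (Suc n) (layout v)" "\<lambda>_. M" M] layout_bounds(3)
        by (simp add: drop_digits_def[of "Suc n" "layout v"])
    qed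
    ultimately show "real M / (q - 1) - val q (drop_digits (Suc n) (layout v)) < 1"
      using gap val_const[OF q, of M] by simp
  qed
qed

text \<open>A gain of at least 1 at place p outweighs the loss of a tail of value at most 1 -
  \<open>gap\<close>.\<close>

lemma layout_val_diff:
  assumes "layout v p < layout w p" "\<And>i. i < p \<Longrightarrow> layout v i = layout w i"
  shows "gap / q ^ Suc p \<le> val q (layout w) - val q (layout v)"
proof -
  have "(val q (layout w) - val q (layout v)) * q ^ Suc p =
      real (layout w p) - real (layout v p) + val q (drop_digits (Suc p) (layout w)) - val q (drop_digits (Suc p) (layout v))"
    using val_diff_at[of q "layout v" M "layout w" M p] q layout_bounds(3) assms(2) by blast
  moreover have "0 \<le> val q (drop_digits (Suc p) (layout w))"
    using layout_bounds(3) by (intro val_nonneg[OF q, of _ M]) (simp add: drop_digits_def)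
  moreover have "val q (drop_digits (Suc p) (layout v)) \<le> 1 - gap" by (rule layout_tail_le) simp
  ultimately have "gap \<le> (val q (layout w) - val q (layout v)) * q ^ Suc p" using assms(1) by linarith
  then show ?thesis using q by (simp add: pos_divide_le_eq)
qed

end

text \<open>The value is at most 1 in base K + 1 and, by two leading digits K, at least 1 in base K
  + 1/2; continuity gives q. The total being 1, the l leading digits K contribute 1 minus the rest,
  and the digit K at place l + 1 makes the rest at least \<open>gap\<close>.\<close>

lemma exists_layout_base:
  obtains q where "real K + 1 / 2 \<le> q" "q \<le> real K + 1" "val q (layout v) = 1"
    "(\<Sum>i<l. real K / q ^ Suc i) \<le> 1 - gap"
proof -
  have K1: "1 \<le> real K" using N K by simp
  define a where "a = real K + 1 / 2"
  have a: "1 < a" using K1 by (simp add: a_def)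
  have "val (real K + 1) (layout v) \<le> real K / (real K + 1 - 1)"
    using K1 layout_bounds(2) by (intro val_le) auto
  then have hi: "val (real K + 1) (layout v) \<le> 1" using K1 by simp
  have "a\<^sup>2 \<le> real K * a + real K" using K1 by (simp add: a_def power2_eq_square algebra_simps)
  then have "1 \<le> (real K * a + real K) / a\<^sup>2" using a by (simp add: le_divide_eq)
  also have "\<dots> = real K / a + real K / a\<^sup>2" using a by (simp add: field_simps power2_eq_square)
  also have "\<dots> = (\<Sum>i<2. real (layout v i) / a ^ Suc i)"
    using l by (simp add: eval_nat_numeral layout_def)
  also have "\<dots> \<le> val a (layout v)"
  proof -
    have "0 \<le> val a (drop_digits 2 (layout v))"
      using layout_bounds(3) by (intro val_nonneg[OF a, of _ M]) (simp add: drop_digits_def)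
    then show ?thesis using val_split[of a "layout v" M 2] a layout_bounds(3) by simp
  qed
  finally have lo: "1 \<le> val a (layout v)" .
  have "continuous_on {a..real K + 1} (\<lambda>q. val q (layout v))"
    using a layout_bounds(3) by (rule continuous_on_val)
  then obtain q where q: "a \<le> q" "q \<le> real K + 1" "val q (layout v) = 1"
    using IVT2'[of "\<lambda>q. val q (layout v)" "real K + 1" 1 a] lo hi by (auto simp: a_def)
  have q1: "1 < q" using a q by simp
  have "(\<Sum>i<l. real K / q ^ Suc i) = (\<Sum>i<l. real (layout v i) / q ^ Suc i)"
    by (intro sum.cong) (auto simp: layout_def)
  moreover have "gap \<le> real (layout v (l + 1)) / q ^ Suc (l + 1)"
  proof -
    have "layout v (l + 1) = K" using l by (simp add: layout_def mod_Suc)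
    moreover have "1 / (real K + 1) ^ (l + 2) \<le> real K / q ^ (l + 2)"
      using K1 q q1 by (intro frac_le power_mono) auto
    ultimately show ?thesis by (simp add: gap_def)
  qed
  moreover have "0 \<le> val q (drop_digits (l + 2) (layout v)) / q ^ (l + 2)"
    using layout_bounds(3) q1
    by (intro divide_nonneg_nonneg val_nonneg[OF q1, of _ M]) (auto simp: drop_digits_def)
  moreover have "0 \<le> real (layout v l) / q ^ Suc l" using q1 by simp
  moreover have "1 = (\<Sum>i<l. real (layout v i) / q ^ Suc i) + real (layout v l) / q ^ Suc l +
      real (layout v (l + 1)) / q ^ Suc (l + 1) + val q (drop_digits (l + 2) (layout v)) / q ^ (l + 2)"
    using val_split[of q "layout v" M "l + 2"] q1 layout_bounds(3) q(3) by simp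
  ultimately have "(\<Sum>i<l. real K / q ^ Suc i) \<le> 1 - gap" by linarith
  then show ?thesis using that q by (simp add: a_def)
qed

definition layout_base :: "(nat \<Rightarrow> nat) \<Rightarrow> real" where
  "layout_base v = (SOME q. real K + 1 / 2 \<le> q \<and> q \<le> real K + 1 \<and> val q (layout v) = 1 \<and>
     (\<Sum>i<l. real K / q ^ Suc i) \<le> 1 - gap)"

lemma layout_base:
  "real K + 1 / 2 \<le> layout_base v" "layout_base v \<le> real K + 1" "val (layout_base v) (layout v) = 1"
  "(\<Sum>i<l. real K / layout_base v ^ Suc i) \<le> 1 - gap" "1 < layout_base v"
proof -
  have *: "real K + 1 / 2 \<le> layout_base v \<and> layout_base v \<le> real K + 1 \<and> val (layout_base v) (layout v) = 1 \<and>
     (\<Sum>i<l. real K / layout_base v ^ Suc i) \<le> 1 - gap"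
    unfolding layout_base_def by (rule someI_ex) (metis exists_layout_base)
  then show "real K + 1 / 2 \<le> layout_base v" "layout_base v \<le> real K + 1" "val (layout_base v) (layout v) = 1"
    "(\<Sum>i<l. real K / layout_base v ^ Suc i) \<le> 1 - gap" by auto
  have "1 \<le> real K" using N K by simp
  then show "1 < layout_base v" using * by linarith
qed

text \<open>Each block carries (N + 1)^(l - 2) symbols and refines the scale by the factor (K +
  1)^l.\<close>

definition dim_bound :: real where
  "dim_bound = ln (real ((N + 1) ^ (l - 2))) / ln ((real K + 1) ^ l)"

text \<open>The square accounts for two blocks besides the n: the initial one and the one that
  stores \<open>v n\<close>.\<close>

lemma separated_position:
  assumes "v n < (N + 1) ^ (l - 2)" "w n < (N + 1) ^ (l - 2)" "v n \<noteq> w n"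
  obtains p where "1 / ((real K + 1) ^ l) ^ 2 / ((real K + 1) ^ l) ^ n \<le> 1 / (real K + 1) ^ Suc p"
    "layout v p \<noteq> layout w p" "\<And>i. i < p \<Longrightarrow> layout v i = layout w i"
proof -
  obtain p where p: "p < l * (n + 2)" "layout v p \<noteq> layout w p" "\<And>i. i < p \<Longrightarrow> layout v i = layout w i"
    using layout_separates[of v n w] assms by blast
  have "1 / ((real K + 1) ^ l) ^ 2 / ((real K + 1) ^ l) ^ n = 1 / (real K + 1) ^ (l * (n + 2))"
    by (simp add: power_add power2_eq_square flip: power_mult)
  also have "\<dots> \<le> 1 / (real K + 1) ^ Suc p"
    using p(1) by (intro divide_left_mono power_increasing) auto
  finally show ?thesis using that p by blast
qed

lemma two_le_block: "2 \<le> (N + 1) ^ (l - 2)"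
proof -
  have "2 ^ 1 \<le> (N + 1) ^ (l - 2)"
    using N l by (intro order_trans[OF power_increasing power_mono]) auto
  then show ?thesis by simp
qed

lemma one_less_scale: "1 < (real K + 1) ^ l"
  using N K l by (intro one_less_power) auto

lemma not_covering_null_univoque_set: "\<not> covering_null dim_bound (univoque_set M (real K + 1))"
  unfolding dim_bound_def
proof (rule not_covering_null_digit_family[where g = "\<lambda>v. val (real K + 1) (layout v)"
      and \<kappa> = "gap * (1 / ((real K + 1) ^ l) ^ 2)"])
  have K1: "1 \<le> real K" using N K by simp
  then have q: "1 < real K + 1" by simp
  \<comment> \<open>In base K + 1 the constant sequence K has value 1, so l digits K fall short of 1
    by (K + 1)^(-l).\<close>
  have W: "(\<Sum>i<l. real K / (real K + 1) ^ Suc i) \<le> 1 - gap"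
  proof -
    have const: "val (real K + 1) (\<lambda>_. K) = 1" using val_const[OF q, of K] K1 by simp
    have drop: "drop_digits l (\<lambda>_. K) = (\<lambda>_. K)" by (simp add: drop_digits_def fun_eq_iff)
    have "val (real K + 1) (\<lambda>_. K) = (\<Sum>i<l. real K / (real K + 1) ^ Suc i) +
        val (real K + 1) (drop_digits l (\<lambda>_. K)) / (real K + 1) ^ l"
      by (rule val_split[of _ _ K, OF q]) simp
    then have "1 = (\<Sum>i<l. real K / (real K + 1) ^ Suc i) + 1 / (real K + 1) ^ l"
      unfolding drop const .
    moreover have "gap \<le> 1 / (real K + 1) ^ l"
      unfolding gap_def by (intro divide_left_mono power_increasing) auto
    ultimately show ?thesis by linarith
  qed
  show "val (real K + 1) (layout v) \<in> univoque_set M (real K + 1)" for v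
    using layout_univoque[OF q W, of v] val_nonneg[OF q layout_bounds(3)] val_le[OF q layout_bounds(3)]
    by (simp add: univoque_set_def)
  fix v w :: "nat \<Rightarrow> nat" and n
  assume "\<And>i. v i < (N + 1) ^ (l - 2)" "\<And>i. w i < (N + 1) ^ (l - 2)" "v n \<noteq> w n"
  then obtain p where p: "1 / ((real K + 1) ^ l) ^ 2 / ((real K + 1) ^ l) ^ n \<le> 1 / (real K + 1) ^ Suc p"
    "layout v p \<noteq> layout w p" "\<And>i. i < p \<Longrightarrow> layout v i = layout w i"
    using separated_position[of v n w] by blast
  have "gap * (1 / ((real K + 1) ^ l) ^ 2) / ((real K + 1) ^ l) ^ n \<le> gap / (real K + 1) ^ Suc p"
    using mult_left_mono[OF p(1), of gap] gap by simp
  also have "\<dots> \<le> \<bar>val (real K + 1) (layout v) - val (real K + 1) (layout w)\<bar>"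
    using layout_val_diff[OF q W, of v p w] layout_val_diff[OF q W, of w p v] p(2,3)
    by (cases "layout v p < layout w p") fastforce+
  finally show "gap * (1 / ((real K + 1) ^ l) ^ 2) / ((real K + 1) ^ l) ^ n
      \<le> \<bar>val (real K + 1) (layout v) - val (real K + 1) (layout w)\<bar>" .
qed (use gap two_le_block one_less_scale in auto)

text \<open>The set records more than uniqueness: bases above K, digits up to K and a positive digit
  followed by c. For c = 0 this is the information that excludes all other alphabets.\<close>

lemma not_covering_null_univoque_bases:
  "\<not> covering_null dim_bound {q. real K < q \<and> q \<le> real K + 1 \<and> (\<exists>!d. is_expansion M q 1 d) \<and>
      (\<exists>d n. is_expansion M q 1 d \<and> (\<forall>i. d i \<le> K) \<and> 0 < d n \<and> d (Suc n) = c)}"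
  unfolding dim_bound_def
proof (rule not_covering_null_digit_family[where g = layout_base
      and \<kappa> = "gap / (4 * real M) * (1 / ((real K + 1) ^ l) ^ 2)"])
  show "layout_base v \<in> {q. real K < q \<and> q \<le> real K + 1 \<and> (\<exists>!d. is_expansion M q 1 d) \<and>
      (\<exists>d n. is_expansion M q 1 d \<and> (\<forall>i. d i \<le> K) \<and> 0 < d n \<and> d (Suc n) = c)}" for v
  proof -
    have "is_expansion M (layout_base v) 1 (layout v)" "\<exists>!d. is_expansion M (layout_base v) 1 d"
      using layout_univoque[OF layout_base(5,4), of v v] layout_base(3) by simp_all
    \<comment> \<open>Place l - 1 ends the initial block of digits K, and place l carries c.\<close>
    moreover have "0 < layout v (l - 1)" "layout v (Suc (l - 1)) = c"
      using l c_less_K by (auto simp: layout_def)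
    ultimately show ?thesis using layout_base[of v] layout_bounds(2) by fastforce
  qed
  fix v w :: "nat \<Rightarrow> nat" and n
  assume "\<And>i. v i < (N + 1) ^ (l - 2)" "\<And>i. w i < (N + 1) ^ (l - 2)" "v n \<noteq> w n"
  then obtain p where p: "1 / ((real K + 1) ^ l) ^ 2 / ((real K + 1) ^ l) ^ n \<le> 1 / (real K + 1) ^ Suc p"
    "layout v p \<noteq> layout w p" "\<And>i. i < p \<Longrightarrow> layout v i = layout w i"
    using separated_position[of v n w] by blast
  have M0: "0 < real M" and K1: "1 \<le> real K" using N K M by auto
  \<comment> \<open>In the base of x, the layout of y has a larger value than that of x, which is 1.
    So the base of y is larger, and the Lipschitz bound with a = 3/2, of constant 4 M, turns the
    difference of values into one of bases.\<close>
  have main: "gap / (4 * real M) / (real K + 1) ^ Suc p \<le> \<bar>layout_base x - layout_base y\<bar>"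
    if "layout x p < layout y p" "\<And>i. i < p \<Longrightarrow> layout x i = layout y i" for x y
  proof -
    note X = layout_base[of x] and Y = layout_base[of y]
    have "gap / (real K + 1) ^ Suc p \<le> gap / layout_base x ^ Suc p"
      using gap X by (intro divide_left_mono power_mono) auto
    also have "\<dots> \<le> val (layout_base x) (layout y) - val (layout_base x) (layout x)"
      by (rule layout_val_diff[OF X(5,4) that])
    also have "\<dots> = val (layout_base x) (layout y) - val (layout_base y) (layout y)"
      using X(3) Y(3) by simp
    finally have diff: "gap / (real K + 1) ^ Suc p \<le> val (layout_base x) (layout y) - val (layout_base y) (layout y)" .
    have "0 < gap / (real K + 1) ^ Suc p" using gap by simp
    then have "layout_base x \<le> layout_base y"
      using diff val_antimono_base[OF Y(5), of "layout_base x" "layout y" M] layout_bounds(3) by force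
    then have "val (layout_base x) (layout y) - val (layout_base y) (layout y) \<le>
        real M / (3 / 2 - 1)\<^sup>2 * (layout_base y - layout_base x)"
      using X(1) K1 layout_bounds(3) by (intro val_lipschitz) auto
    also have "real M / (3 / 2 - 1)\<^sup>2 = 4 * real M" by (simp add: power2_eq_square)
    finally have "gap / (real K + 1) ^ Suc p \<le> (layout_base y - layout_base x) * (4 * real M)"
      using diff by (simp add: mult.commute)
    then have "gap / (real K + 1) ^ Suc p / (4 * real M) \<le> layout_base y - layout_base x"
      using M0 by (simp only: pos_divide_le_eq mult_pos_pos zero_less_numeral)
    then show ?thesis by (simp add: mult.commute)
  qed
  have "gap / (4 * real M) * (1 / ((real K + 1) ^ l) ^ 2) / ((real K + 1) ^ l) ^ n \<le>
      gap / (4 * real M) / (real K + 1) ^ Suc p"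
    using mult_left_mono[OF p(1), of "gap / (4 * real M)"] gap by simp
  also have "\<dots> \<le> \<bar>layout_base v - layout_base w\<bar>"
    using main[of v w] main[of w v] p(2,3) by (cases "layout v p < layout w p") fastforce+
  finally show "gap / (4 * real M) * (1 / ((real K + 1) ^ l) ^ 2) / ((real K + 1) ^ l) ^ n
      \<le> \<bar>layout_base v - layout_base w\<bar>" .
qed (use gap two_le_block one_less_scale N M in auto)

lemma dim_bound_eq: "dim_bound = (1 - 2 / real l) * (ln (real N + 1) / ln (real K + 1))"
proof -
  have "dim_bound = (real (l - 2) * ln (real N + 1)) / (real l * ln (real K + 1))"
    by (simp add: dim_bound_def ln_realpow add.commute)
  also have "\<dots> = (real (l - 2) / real l) * (ln (real N + 1) / ln (real K + 1))" by simp
  also have "real (l - 2) / real l = 1 - 2 / real l" using l by (simp add: field_simps of_nat_diff)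
  finally show ?thesis .
qed

end

text \<open>Letting l grow removes the loss 2 / l caused by the two fixed digits per block.\<close>

lemma hausdorff_dim_ge_block_layout:
  assumes "\<And>l. 3 \<le> l \<Longrightarrow> \<not> covering_null ((1 - 2 / real l) * s) A" "bounded A"
  shows "s \<le> hausdorff_dim A"
proof (rule LIMSEQ_le_const2)
  show "(\<lambda>l. (1 - 2 / real l) * s) \<longlonglongrightarrow> s"
    using tendsto_mult[OF tendsto_diff[OF tendsto_const lim_const_over_n] tendsto_const, of 1 2 s] by simp
  show "\<exists>L. \<forall>l\<ge>L. (1 - 2 / real l) * s \<le> hausdorff_dim A"
    using assms hausdorff_dim_ge by blast
qed

section \<open>The dimension formulas\<close>

lemma bounded_univoque_set: "bounded (univoque_set M q)"
  by (rule bounded_subset[of "{0..real M / (q - 1)}"]) (auto simp: univoque_set_def)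

lemma bounded_univoque_bases: "bounded (univoque_bases J)"
  by (rule bounded_subset[of "{1..real J + 1}"]) (auto simp: univoque_bases_def)

lemma exists_expansion_one:
  assumes "1 < q" "q \<le> real J + 1"
  obtains d where "is_expansion J q 1 d"
  using exists_expansion[OF assms, of 1] assms by (auto simp: le_divide_eq)

lemma is_expansion_mono: "is_expansion J q x d \<Longrightarrow> J \<le> M \<Longrightarrow> is_expansion M q x d"
  unfolding is_expansion_def by (meson le_trans)

lemma Inter_univoque_bases:
  assumes "K \<le> M"
  shows "(\<Inter>J\<in>{K..M}. univoque_bases J) = univoque_bases M \<inter> {..real K + 1}"
proof
  show "(\<Inter>J\<in>{K..M}. univoque_bases J) \<subseteq> univoque_bases M \<inter> {..real K + 1}"
  proof
    fix q assume "q \<in> (\<Inter>J\<in>{K..M}. univoque_bases J)"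
    then have "q \<in> univoque_bases M" "q \<in> univoque_bases K" using assms by auto
    then show "q \<in> univoque_bases M \<inter> {..real K + 1}" by (simp add: univoque_bases_def)
  qed
  show "univoque_bases M \<inter> {..real K + 1} \<subseteq> (\<Inter>J\<in>{K..M}. univoque_bases J)"
  proof (intro subsetI INT_I)
    fix q J assume q: "q \<in> univoque_bases M \<inter> {..real K + 1}" and J: "J \<in> {K..M}"
    then have q': "1 < q" "q \<le> real J + 1" by (auto simp: univoque_bases_def)
    obtain d where "is_expansion J q 1 d" using exists_expansion_one[OF q'] .
    moreover have "\<exists>!d. is_expansion M q 1 d" using q by (simp add: univoque_bases_def)
    ultimately have "\<exists>!d. is_expansion J q 1 d" using is_expansion_mono[of J q 1 _ M] J by (metis atLeastAtMost_iff)
    then show "q \<in> univoque_bases J" using q' by (simp add: univoque_bases_def)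
  qed
qed

text \<open>Here M / (q - 1) >= 2, so a digit strictly between 0 and M would force the next tail to
  be both below 1 and above 1. A sequence of digits 0 and M cannot switch between them.\<close>

lemma univoque_set_trivial:
  assumes K: "0 < K" "2 * K \<le> M" and q: "1 < q" "q \<le> real K + 1"
  shows "univoque_set M q \<subseteq> {0, real M / (q - 1)}"
proof
  fix x assume "x \<in> univoque_set M q"
  then obtain d where d: "is_expansion M q x d" and uniq: "\<exists>!d. is_expansion M q x d"
    by (auto simp: univoque_set_def)
  have qM: "q \<le> real M + 1" using K q by simp
  have bd: "\<And>i. d i \<le> M" "val q d = x" using d q by (auto simp: is_expansion_iff_val)
  note up = univoque_tail_lt[OF q(1) qM uniq d] and down = univoque_tail_gt[OF q(1) qM uniq d]
  have two: "2 \<le> real M / (q - 1)"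
  proof -
    have "2 * (q - 1) \<le> real M" using of_nat_mono[OF K(2), where 'a = real] q by simp
    then show ?thesis using q by (simp add: le_divide_eq)
  qed
  have digits: "d n = 0 \<or> d n = M" for n
  proof (rule ccontr)
    assume "\<not> (d n = 0 \<or> d n = M)"
    then have "0 < d n" "d n < M" using bd(1)[of n] by auto
    then show False using up[of n] down[of n] two by linarith
  qed
  have step: "q * val q (drop_digits (Suc n) d) = real (d (Suc n)) + val q (drop_digits (Suc (Suc n)) d)" for n
    using val_drop_step[of q d M "Suc n"] q bd by simp
  have nonneg: "0 \<le> val q (drop_digits n d)" for n
    using bd by (intro val_nonneg[OF q(1), of _ M]) (simp add: drop_digits_def)
  \<comment> \<open>After 0 the next digit is at most K < M, hence 0. After M the tail exceeds 1; a
    digit 0 would multiply it by q, yet the tail after that 0 must be below 1.\<close>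
  have const: "d (Suc n) = d n" for n
  proof (cases "d n = 0")
    case True
    then have "q * val q (drop_digits (Suc n) d) < q * 1"
      using up[of n] K q by (intro mult_strict_left_mono) auto
    then have "real (d (Suc n)) < real K + 1" using step[of n] nonneg[of "Suc (Suc n)"] q by linarith
    then show ?thesis using digits[of "Suc n"] True K by auto
  next
    case False
    then have dn: "d n = M" using digits[of n] by simp
    then have *: "1 < val q (drop_digits (Suc n) d)" using down[of n] K two by simp
    have "d (Suc n) \<noteq> 0"
    proof
      assume 0: "d (Suc n) = 0"
      have "q * 1 < q * val q (drop_digits (Suc n) d)" using * q by (intro mult_strict_left_mono) auto
      then show False using step[of n] up[of "Suc n"] 0 K q by simp
    qed
    then show ?thesis using digits[of "Suc n"] dn by simp
  qed
  have "d n = d 0" for n by (induction n) (simp_all add: const)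
  then have "d = (\<lambda>_. d 0)" by auto
  then show "x \<in> {0, real M / (q - 1)}"
    using digits[of 0] bd(2) val_const[OF q(1), of 0] val_const[OF q(1), of M] by auto
qed

lemma univoque_bases_trivial:
  assumes K: "0 < K" "2 * K \<le> M"
  shows "univoque_bases M \<inter> {..real K + 1} = {}"
proof (rule ccontr)
  assume "univoque_bases M \<inter> {..real K + 1} \<noteq> {}"
  then obtain q where q: "1 < q" "q \<le> real K + 1" "\<exists>!d. is_expansion M q 1 d"
    by (auto simp: univoque_bases_def)
  have two': "2 * (q - 1) \<le> real M" using of_nat_mono[OF K(2), where 'a = real] q by simp
  then have two: "2 \<le> real M / (q - 1)" using q by (simp add: le_divide_eq)
  have "1 \<in> univoque_set M q" using q two' by (simp add: univoque_set_def)
  then show False using univoque_set_trivial[OF K q(1,2)] two by auto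
qed

lemma hausdorff_dim_countable:
  assumes "countable A" "bounded A"
  shows "hausdorff_dim A = 0"
  using assms by (intro antisym hausdorff_dim_le hausdorff_dim_nonneg covering_null_countable) auto

lemma hausdorff_dim_univoque_sets:
  assumes N: "0 < N" "K = N + c" "M = N + 2 * c"
  defines "s \<equiv> ln (real N + 1) / ln (real K + 1)"
  shows "hausdorff_dim (univoque_bases M \<inter> {..real K + 1}) = s"
    and "hausdorff_dim (univoque_set M (real K + 1)) = s"
    and "1 < q \<Longrightarrow> q \<le> real K + 1 \<Longrightarrow> hausdorff_dim (univoque_set M q) \<le> s"
proof -
  have s0: "0 \<le> s" by (simp add: s_def)
  have upper_set: "covering_null t (univoque_set M q)" if "1 < q" "q \<le> real K + 1" "s < t" for q t
  proof (cases "c = 0")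
    case True
    \<comment> \<open>For c = 0 the numbers N, K and M agree, so s = 1 and boundedness is
      enough.\<close>
    then have "s = 1" using N by (simp add: s_def)
    then show ?thesis using that bounded_univoque_set by (intro covering_null_bounded) auto
  next
    case False
    then show ?thesis using covering_null_univoque_set[of N c K M q t] N that by (simp add: s_def)
  qed
  then show le: "hausdorff_dim (univoque_set M q) \<le> s" if "1 < q" "q \<le> real K + 1" for q
    using that s0 by (intro hausdorff_dim_le) auto
  have upper_bases: "covering_null t (univoque_bases M \<inter> {..real K + 1})" if "s < t" for t
  proof (cases "c = 0")
    case True
    then have "s = 1" using N by (simp add: s_def)
    then show ?thesis using that bounded_univoque_bases by (intro covering_null_bounded bounded_Int) auto
  next
    case False
    then show ?thesis using covering_null_univoque_bases[of N c K M t] N that by (simp add: s_def)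
  qed
  have layout: "block_layout N c K M l" if "3 \<le> l" for l
    using N that by unfold_locales
  have "s \<le> hausdorff_dim (univoque_set M (real K + 1))"
  proof (rule hausdorff_dim_ge_block_layout[OF _ bounded_univoque_set])
    fix l :: nat assume "3 \<le> l"
    then interpret block_layout N c K M l by (rule layout)
    show "\<not> covering_null ((1 - 2 / real l) * s) (univoque_set M (real K + 1))"
      using not_covering_null_univoque_set by (simp add: dim_bound_eq s_def)
  qed
  then show "hausdorff_dim (univoque_set M (real K + 1)) = s"
    using le[of "real K + 1"] N by simp
  have KM: "1 \<le> real K" "K \<le> M" using N by simp_all
  have sub: "{q. real K < q \<and> q \<le> real K + 1 \<and> (\<exists>!d. is_expansion M q 1 d) \<and>
      (\<exists>d n. is_expansion M q 1 d \<and> (\<forall>i. d i \<le> K) \<and> 0 < d n \<and> d (Suc n) = c)} \<subseteq> univoque_bases M \<inter> {..real K + 1}"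
    (is "?S \<subseteq> _")
  proof
    fix q assume "q \<in> ?S"
    then have "real K < q" "q \<le> real K + 1" "\<exists>!d. is_expansion M q 1 d" by blast+
    then show "q \<in> univoque_bases M \<inter> {..real K + 1}" using KM by (simp add: univoque_bases_def)
  qed
  have "s \<le> hausdorff_dim (univoque_bases M \<inter> {..real K + 1})"
  proof (rule hausdorff_dim_ge_block_layout)
    fix l :: nat assume "3 \<le> l"
    then interpret block_layout N c K M l by (rule layout)
    show "\<not> covering_null ((1 - 2 / real l) * s) (univoque_bases M \<inter> {..real K + 1})"
      using not_covering_null_univoque_bases covering_null_subset[OF _ sub] by (auto simp: dim_bound_eq s_def)
  qed (use bounded_univoque_bases in \<open>auto intro: bounded_Int\<close>)
  moreover have "hausdorff_dim (univoque_bases M \<inter> {..real K + 1}) \<le> s"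
    using upper_bases s0 by (intro hausdorff_dim_le) auto
  ultimately show "hausdorff_dim (univoque_bases M \<inter> {..real K + 1}) = s" by simp
qed

text \<open>For J < L the base exceeds J + 1. For J > L the digit 0 makes the tail there less than 1
  / q < 1 / L, while uniqueness after the positive digit requires more than J / (q - 1) - 1 >= 1 /
  L.\<close>

lemma univoque_bases_only:
  assumes L: "0 < L" and q: "real L < q" "q \<le> real L + 1" and uniq: "\<exists>!d. is_expansion L q 1 d"
    and d: "is_expansion L q 1 d" "0 < d n" "d (Suc n) = 0"
  shows "q \<in> univoque_bases L - (\<Union>J\<in>{J. 0 < J \<and> J \<noteq> L}. univoque_bases J)"
proof -
  have q1: "1 < q" using L q by linarith
  have "q \<notin> univoque_bases J" if "0 < J" "J \<noteq> L" for J
  proof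
    assume "q \<in> univoque_bases J"
    then have J: "q \<le> real J + 1" "\<exists>!d. is_expansion J q 1 d" by (auto simp: univoque_bases_def)
    then have LJ: "L < J" using q that by linarith
    then have dJ: "is_expansion J q 1 d" using d is_expansion_mono by simp
    note up = univoque_tail_lt[OF q1 J dJ] and down = univoque_tail_gt[OF q1 J dJ]
    have "q * val q (drop_digits (Suc n) d) = val q (drop_digits (Suc (Suc n)) d)"
      using val_drop_step[of q d J "Suc n"] q1 dJ d(3) by (simp add: is_expansion_def)
    also have "\<dots> < 1" using up[of "Suc n"] d(3) that by simp
    finally have "val q (drop_digits (Suc n) d) < 1 / q" using q1 by (simp add: less_divide_eq mult.commute)
    also have "\<dots> < 1 / real L" using q L q1 by (simp add: frac_less2)
    finally have "real J / (q - 1) < 1 + 1 / real L" using down[OF d(2)] by simp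
    moreover have "1 + 1 / real L = (real L + 1) / real L" using L by (simp add: field_simps)
    moreover have "(real L + 1) / real L \<le> real J / (q - 1)" using LJ q q1 by (intro frac_le) auto
    ultimately show False by simp
  qed
  moreover have "q \<in> univoque_bases L" using q q1 uniq by (simp add: univoque_bases_def)
  ultimately show ?thesis by auto
qed

lemma hausdorff_dim_univoque_bases_only:
  assumes L: "0 < L"
  shows "hausdorff_dim (univoque_bases L - (\<Union>J\<in>{J. 0 < J \<and> J \<noteq> L}. univoque_bases J)) = 1" (is "hausdorff_dim ?A = 1")
proof (rule antisym)
  have bdd: "bounded ?A" by (rule bounded_subset[OF bounded_univoque_bases[of L]]) auto
  then show "hausdorff_dim ?A \<le> 1" by (intro hausdorff_dim_le covering_null_bounded) auto
  show "1 \<le> hausdorff_dim ?A"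
  proof (rule hausdorff_dim_ge_block_layout[OF _ bdd])
    fix l :: nat assume "3 \<le> l"
    \<comment> \<open>With N = K = M = L and c = 0 the limiting exponent ln (N + 1) / ln (K + 1) is
      1.\<close>
    then interpret block_layout L 0 L L l using L by unfold_locales auto
    have dim: "(1 - 2 / real l) * 1 = dim_bound" using L by (simp add: dim_bound_eq)
    have sub: "{q. real L < q \<and> q \<le> real L + 1 \<and> (\<exists>!d. is_expansion L q 1 d) \<and>
      (\<exists>d n. is_expansion L q 1 d \<and> (\<forall>i. d i \<le> L) \<and> 0 < d n \<and> d (Suc n) = 0)} \<subseteq> ?A"
      using univoque_bases_only[OF L] by blast
    show "\<not> covering_null ((1 - 2 / real l) * 1) ?A"
      unfolding dim using not_covering_null_univoque_bases covering_null_subset[OF _ sub] by blast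
  qed
qed

theorem theorem4:
  fixes M :: nat
  assumes "0 < M"
  shows "(\<forall>K\<in>{1..M}.
            (\<exists>q. 1 < q \<and> q \<le> real K + 1 \<and>
                 hausdorff_dim (\<Inter>J\<in>{K..M}. univoque_bases J) = hausdorff_dim (univoque_set M q)) \<and>
            (\<forall>q. 1 < q \<and> q \<le> real K + 1 \<longrightarrow>
                 hausdorff_dim (univoque_set M q) \<le> hausdorff_dim (\<Inter>J\<in>{K..M}. univoque_bases J)))
         \<and> (\<forall>L::nat. 0 < L \<longrightarrow>
              hausdorff_dim (univoque_bases L - (\<Union>J\<in>{J. 0 < J \<and> J \<noteq> L}. univoque_bases J)) = 1)"
proof (intro conjI ballI allI impI hausdorff_dim_univoque_bases_only)
  fix K assume "K \<in> {1..M}"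
  then have K: "0 < K" "K \<le> M" by auto
  let ?A = "\<Inter>J\<in>{K..M}. univoque_bases J"
  have A: "?A = univoque_bases M \<inter> {..real K + 1}" by (rule Inter_univoque_bases[OF K(2)])
  have q: "1 < real K + 1" using K by simp
  \<comment> \<open>In both cases q = K + 1 attains the maximum.\<close>
  have "hausdorff_dim ?A = hausdorff_dim (univoque_set M (real K + 1)) \<and>
      (\<forall>q. 1 < q \<and> q \<le> real K + 1 \<longrightarrow> hausdorff_dim (univoque_set M q) \<le> hausdorff_dim ?A)"
  proof (cases "2 * K \<le> M")
    case True
    have "hausdorff_dim (univoque_set M q) = 0" if "1 < q" "q \<le> real K + 1" for q
      using univoque_set_trivial[OF K(1) True that] bounded_univoque_set
      by (intro hausdorff_dim_countable) (auto dest: countable_subset)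
    moreover have "hausdorff_dim ?A = 0"
      unfolding A univoque_bases_trivial[OF K(1) True] by (rule hausdorff_dim_countable) auto
    ultimately show ?thesis using q by simp
  next
    case False
    define N c where "N = 2 * K - M" and "c = M - K"
    have "0 < N" "K = N + c" "M = N + 2 * c" using False K by (auto simp: N_def c_def)
    note dim = hausdorff_dim_univoque_sets[OF this]
    show ?thesis unfolding A dim(1) dim(2) using dim(3) by simp
  qed
  then show "\<exists>q. 1 < q \<and> q \<le> real K + 1 \<and> hausdorff_dim ?A = hausdorff_dim (univoque_set M q)"
    and "\<And>q. 1 < q \<and> q \<le> real K + 1 \<Longrightarrow> hausdorff_dim (univoque_set M q) \<le> hausdorff_dim ?A"
    using q by (auto intro!: exI[of _ "real K + 1"])
qed

end
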